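(* Let $d\ge1$, $\boldsymbol\nu\in\mathbb C^d$, $\boldsymbol\varsigma\in\{+,-\}^{d+1}$, and put $\mathfrak c=\max_l|\nu_l|+1$, $\mathfrak r=\max_l|\mathrm{Re}\,\nu_l|$. Let $j$ and $M$ be nonnegative integers. Suppose that one of the signs $\varsigma_1,\dots,\varsigma_d$ is different from $\varsigma_{d+1}$. Then $$J^{(j)}_{\boldsymbol\nu}(x;\boldsymbol\varsigma)\ll_{\mathfrak r,M,j,d}\Big(\frac{\mathfrak c}{x}\Big)^M\qquad\text{for all }x\ge\mathfrak c .$$ In particular, all the derivatives $J^{(j)}_{\boldsymbol\nu}(x;\boldsymbol\varsigma)$ decay rapidly as $x\to\infty$.
   Context: Notation: $e(w)=e^{2\pi iw}$, $\mathbb N=\{0,1,2,\dots\}$. The notation $\ll_{\mathfrak r,M,j,d}$ means that the implied constant depends only on $\mathfrak r,M,j,d$. Put $n=d+1$ and let $\boldsymbol\lambda\in\mathbb C^{n}$ be the unique vector with $\sum_{l=1}^{n}\lambda_l=0$ and $\nu_l=\lambda_l-\lambda_{d+1}$ ($l=1,\dots,d$). Then $J_{\boldsymbol\nu}(x;\boldsymbol\varsigma)=J(x;\boldsymbol\varsigma,\boldsymbol\lambda)$, where for $x>0$ $$J(x;\boldsymbol\varsigma,\boldsymbol\lambda)=\frac1{2\pi i}\int_{\mathcal C}\ \prod_{l=1}^n\Gamma(s-\lambda_l)e\Big(\frac{\varsigma_l(s-\lambda_l)}4\Big)\ x^{-ns}ds,$$ and $\mathcal C$ is any contour going upward from $\sigma-i\infty$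 to $\sigma+i\infty$ with $\sigma<\frac12+\frac1n(\mathrm{Re}\sum_l\lambda_l-1)$, having all the sets $\lambda_l-\mathbb N$ on its left, and such that $\mathrm{Re}\,s=\sigma$ for $s\in\mathcal C$ with $|\mathrm{Im}\,s|$ sufficiently large. *)

theory Defs
  imports "HOL-Complex_Analysis.Complex_Analysis"
begin

text \<open>
  Vectors indexed by \<open>1, \<dots>, n\<close> are functions on \<open>nat\<close>, of which only the values on \<open>{1..n}\<close>
  are used. The signs \<open>+\<close> and \<open>-\<close> are the integers \<open>1\<close> and \<open>-1\<close>.
\<close>

definition e_fun :: "complex \<Rightarrow> complex" where
  "e_fun w = exp (2 * of_real pi * \<i> * w)"

definition bessel_gamma_factor :: "nat \<Rightarrow> (nat \<Rightarrow> int) \<Rightarrow> (nat \<Rightarrow> complex) \<Rightarrow> complex \<Rightarrow> complex" where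
  "bessel_gamma_factor n \<sigma>s lam s =
     (\<Prod>l = 1..n. Gamma (s - lam l) * e_fun (of_int (\<sigma>s l) * (s - lam l) / 4))"

text \<open>
  A contour from \<open>a - i\<infinity>\<close> to \<open>a + i\<infinity>\<close> which eventually runs on the line \<open>Re s = a\<close> is
  parametrized by the whole real line, in such a way that far out the parameter is the imaginary
  part. The bounded middle portion is an arbitrary piecewise continuously differentiable path.
\<close>

definition upward_contour :: "real \<Rightarrow> (real \<Rightarrow> complex) \<Rightarrow> bool" where
  "upward_contour a \<gamma> \<longleftrightarrow>
     (\<exists>T>0. \<gamma> piecewise_C1_differentiable_on {-T..T} \<and> (\<forall>t. \<bar>t\<bar> \<ge> T \<longrightarrow> \<gamma> t = Complex a t))"

text \<open>
  The left side of an upward contour is the connected component of its complement that contains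
  all points of sufficiently small real part. Simplicity of the contour is not required; for
  a simple contour the complement has exactly two components and this is the left one.
\<close>

definition left_side :: "(real \<Rightarrow> complex) \<Rightarrow> complex set" where
  "left_side \<gamma> =
     {z. \<exists>b. (\<forall>t. b < Re (\<gamma> t)) \<and> connected_component (- range \<gamma>) (of_real b) z}"

definition bessel_contour :: "nat \<Rightarrow> (nat \<Rightarrow> complex) \<Rightarrow> (real \<Rightarrow> complex) \<Rightarrow> bool" where
  "bessel_contour n lam \<gamma> \<longleftrightarrow>
     (\<exists>a. upward_contour a \<gamma> \<and> a < 1/2 + 1 / real n * (Re (\<Sum>l = 1..n. lam l) - 1)) \<and>
     (\<forall>l\<in>{1..n}. \<forall>k::nat. lam l - of_nat k \<in> left_side \<gamma>)"

text \<open>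
  The integral is the contour integral over \<open>\<gamma>\<close>. Its value does not depend on the choice of
  the admissible contour; the contour is kept as an explicit argument so that results can be stated
  for any contour.
\<close>

definition bessel_J ::
    "nat \<Rightarrow> (nat \<Rightarrow> int) \<Rightarrow> (nat \<Rightarrow> complex) \<Rightarrow> (real \<Rightarrow> complex) \<Rightarrow> real \<Rightarrow> complex" where
  "bessel_J n \<sigma>s lam \<gamma> x =
     1 / (2 * of_real pi * \<i>) *
     integral UNIV (\<lambda>t. bessel_gamma_factor n \<sigma>s lam (\<gamma> t) *
                        of_real x powr (- (of_nat n * \<gamma> t)) * vector_derivative \<gamma> (at t))"

definition lambda_of :: "nat \<Rightarrow> (nat \<Rightarrow> complex) \<Rightarrow> nat \<Rightarrow> complex" where
  "lambda_of d \<nu> l =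
     (if l \<in> {1..d} then \<nu> l else 0) - (\<Sum>k = 1..d. \<nu> k) / of_nat (d + 1)"

lemma lambda_of_unique:
  "(\<Sum>l = 1..d + 1. lam l) = 0 \<and> (\<forall>l\<in>{1..d}. \<nu> l = lam l - lam (d + 1)) \<longleftrightarrow>
   (\<forall>l\<in>{1..d + 1}. lam l = lambda_of d \<nu> l)"
proof
  assume A: "(\<Sum>l = 1..d + 1. lam l) = 0 \<and> (\<forall>l\<in>{1..d}. \<nu> l = lam l - lam (d + 1))"
  have "(\<Sum>k = 1..d. \<nu> k) = (\<Sum>k = 1..d. lam k - lam (d + 1))"
    using A by (intro sum.cong) auto
  also have "\<dots> = (\<Sum>k = 1..d + 1. lam k) - of_nat (d + 1) * lam (d + 1)"
    by (simp add: sum_subtractf algebra_simps)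
  finally have S: "(\<Sum>k = 1..d. \<nu> k) = - (of_nat (d + 1) * lam (d + 1))"
    using A by simp
  have nz: "(of_nat (d + 1) :: complex) \<noteq> 0"
    by (simp only: of_nat_eq_0_iff)
  have L: "lam (d + 1) = - ((\<Sum>k = 1..d. \<nu> k) / of_nat (d + 1))"
    unfolding S using nz by (simp del: of_nat_Suc of_nat_add)
  show "\<forall>l\<in>{1..d + 1}. lam l = lambda_of d \<nu> l"
  proof
    fix l assume l: "l \<in> {1..d + 1}"
    show "lam l = lambda_of d \<nu> l"
    proof (cases "l = d + 1")
      case True
      then show ?thesis using L by (simp add: lambda_of_def)
    next
      case False
      then have "l \<in> {1..d}" using l by auto
      then show ?thesis using A L unfolding lambda_of_def by (auto simp: algebra_simps)
    qed
  qed
next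
  assume A: "\<forall>l\<in>{1..d + 1}. lam l = lambda_of d \<nu> l"
  have nz: "(of_nat (d + 1) :: complex) \<noteq> 0"
    by (simp only: of_nat_eq_0_iff)
  have "(\<Sum>l = 1..d + 1. lam l) = (\<Sum>l = 1..d + 1. lambda_of d \<nu> l)"
    using A by (intro sum.cong) auto
  also have "\<dots> = (\<Sum>l = 1..d + 1. if l \<in> {1..d} then \<nu> l else 0)
      - of_nat (d + 1) * ((\<Sum>k = 1..d. \<nu> k) / of_nat (d + 1))"
    unfolding lambda_of_def sum_subtractf by simp
  also have "(\<Sum>l = 1..d + 1. if l \<in> {1..d} then \<nu> l else 0) = (\<Sum>k = 1..d. \<nu> k)"
    by simp
  finally have "(\<Sum>l = 1..d + 1. lam l) = 0"
    using nz by (simp del: of_nat_Suc of_nat_add)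
  with A show "(\<Sum>l = 1..d + 1. lam l) = 0 \<and> (\<forall>l\<in>{1..d}. \<nu> l = lam l - lam (d + 1))"
    by (auto simp: lambda_of_def)
qed

definition bessel_J_nu ::
    "nat \<Rightarrow> (nat \<Rightarrow> complex) \<Rightarrow> (nat \<Rightarrow> int) \<Rightarrow> (real \<Rightarrow> complex) \<Rightarrow> real \<Rightarrow> complex" where
  "bessel_J_nu d \<nu> \<sigma>s \<gamma> x = bessel_J (d + 1) \<sigma>s (lambda_of d \<nu>) \<gamma> x"

text \<open>
  The iterated derivative is a total function; its existence has to be asserted separately by
  differentiability of the lower derivatives.
\<close>

definition nth_deriv :: "nat \<Rightarrow> (real \<Rightarrow> complex) \<Rightarrow> real \<Rightarrow> complex" where
  "nth_deriv j = (\<lambda>f x. vector_derivative f (at x)) ^^ j"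

definition c_par :: "nat \<Rightarrow> (nat \<Rightarrow> complex) \<Rightarrow> real" where
  "c_par d \<nu> = (MAX l\<in>{1..d}. cmod (\<nu> l)) + 1"

definition r_par :: "nat \<Rightarrow> (nat \<Rightarrow> complex) \<Rightarrow> real" where
  "r_par d \<nu> = (MAX l\<in>{1..d}. \<bar>Re (\<nu> l)\<bar>)"

text \<open>The definition of a contour is not vacuous.\<close>

lemma bessel_contour_exists: "\<exists>\<gamma>. bessel_contour n lam \<gamma>"
proof -
  define a where "a = 1/2 + 1 / real n * (Re (\<Sum>l = 1..n. lam l) - 1) - 1"
  define B where "B = (\<Sum>l = 1..n. \<bar>Re (lam l)\<bar> + \<bar>Im (lam l)\<bar>) + \<bar>a\<bar> + 1"
  define f where "f = (\<lambda>t. a + max 0 (B - \<bar>t\<bar>))"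
  define \<gamma> where "\<gamma> = (\<lambda>t. Complex (f t) t)"
  have B: "B > 0"
    unfolding B_def by (intro add_nonneg_pos add_nonneg_nonneg sum_nonneg) auto
  have eq: "\<gamma> t = of_real (a + B - \<bar>t\<bar>) + \<i> * of_real t" if "t \<in> {-B..B}" for t
    using that by (auto simp: \<gamma>_def f_def complex_eq_iff max_def)
  have C1: "\<gamma> piecewise_C1_differentiable_on {-B..B}"
    unfolding piecewise_C1_differentiable_on_def
  proof (intro conjI exI[of _ "{-B, 0, B}"])
    show "continuous_on {-B..B} \<gamma>"
      unfolding \<gamma>_def f_def Complex_eq by (intro continuous_intros)
    define D where "D = (\<lambda>t::real. - complex_of_real (sgn t) + \<i>)"
    have "(\<gamma> has_vector_derivative D t) (at t)" if "t \<in> {-B..B} - {-B, 0, B}" for t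
    proof -
      have t: "t \<in> {-B<..<B} - {0}" using that by auto
      have "((\<lambda>t. of_real (a + B - sgn t0 * t) + \<i> * complex_of_real t) has_vector_derivative
              - complex_of_real (sgn t0) + \<i>) (at t)" for t0 :: real
        by (auto intro!: derivative_eq_intros simp: has_vector_derivative_def scaleR_conv_of_real
             algebra_simps)
      from this[of t] show ?thesis unfolding D_def
      proof (rule has_vector_derivative_transform_within_open[of _ _ _ "{-B<..<B} \<inter> {s. s * t > 0}"])
        show "open ({-B<..<B} \<inter> {s. s * t > 0})"
          by (intro open_Int open_Collect_less continuous_intros open_greaterThanLessThan)
        show "t \<in> {-B<..<B} \<inter> {s. s * t > 0}"
          using t by (auto simp: zero_less_mult_iff)
        show "of_real (a + B - sgn t * s) + \<i> * of_real s = \<gamma> s"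
          if "s \<in> {-B<..<B} \<inter> {s. s * t > 0}" for s
          using that eq[of s] by (auto simp: zero_less_mult_iff)
      qed
    qed
    moreover have "continuous_on ({-B..B} - {-B, 0, B}) D"
      unfolding D_def by (intro continuous_intros continuous_on_sgn) auto
    ultimately show "\<gamma> C1_differentiable_on {-B..B} - {-B, 0, B}"
      unfolding C1_differentiable_on_def by blast
  qed simp
  have up: "upward_contour a \<gamma>"
    unfolding upward_contour_def using B C1 by (intro exI[of _ B]) (auto simp: \<gamma>_def f_def)
  have left: "z \<in> left_side \<gamma>" if z: "Re z < f (Im z)" for z
  proof -
    define b where "b = min (Re z) (a - 1)"
    have fa: "f t \<ge> a" for t by (simp add: f_def)
    have b: "b < Re (\<gamma> t)" for t
      using fa[of t] by (auto simp: b_def \<gamma>_def)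
    define w where "w = Complex b (Im z)"
    have "closed_segment (of_real b) w \<subseteq> {s. Re s \<le> b}"
      by (rule closed_segment_subset) (auto simp: w_def convex_halfspace_Re_le)
    moreover have "{s. Re s \<le> b} \<subseteq> - range \<gamma>"
      using b by (auto simp flip: not_less)
    ultimately have 1: "closed_segment (of_real b) w \<subseteq> - range \<gamma>"
      by (rule subset_trans)
    have "closed_segment w z \<subseteq> {s. Re s \<le> Re z} \<inter> {s. Im s = Im z}"
      by (rule closed_segment_subset)
         (auto simp: w_def b_def convex_halfspace_Re_le intro!: convex_Int,
          auto simp: convex_def algebra_simps simp flip: distrib_right)
    moreover have "{s. Re s \<le> Re z} \<inter> {s. Im s = Im z} \<subseteq> - range \<gamma>"
      using z by (auto simp: \<gamma>_def)
    ultimately have 2: "closed_segment w z \<subseteq> - range \<gamma>"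
      by (rule subset_trans)
    have "connected_component (- range \<gamma>) (of_real b) w"
      unfolding connected_component_def using 1
      by (intro exI[of _ "closed_segment (of_real b) w"]) auto
    moreover have "connected_component (- range \<gamma>) w z"
      unfolding connected_component_def using 2
      by (intro exI[of _ "closed_segment w z"]) auto
    ultimately show ?thesis
      unfolding left_side_def using b by (blast intro: connected_component_trans)
  qed
  have "lam l - of_nat k \<in> left_side \<gamma>" if "l \<in> {1..n}" for l k
  proof (rule left)
    have "\<bar>Re (lam l)\<bar> + \<bar>Im (lam l)\<bar> \<le> (\<Sum>l = 1..n. \<bar>Re (lam l)\<bar> + \<bar>Im (lam l)\<bar>)"
      using that by (intro member_le_sum) auto
    then show "Re (lam l - of_nat k) < f (Im (lam l - of_nat k))"
      by (auto simp: f_def B_def)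
  qed
  moreover have "a < 1/2 + 1 / real n * (Re (\<Sum>l = 1..n. lam l) - 1)"
    by (simp add: a_def)
  ultimately show ?thesis
    unfolding bessel_contour_def using up by blast
qed

end

theory Submission
  imports Defs
begin

text \<open>
  If two signs differ, then for each sign of \<open>Im s\<close> one of the factors
  \<open>\<Gamma>(s - \<lambda>\<^sub>l) e(\<plusminus>(s - \<lambda>\<^sub>l)/4)\<close> decays like \<open>exp (- \<pi> \<bar>Im s\<bar>)\<close> while the others grow at most
  polynomially. Hence the contour may be moved to any vertical line \<open>Re s = \<sigma>\<close> to the right of
  all poles, and one may differentiate under the integral. On that line Stirling's upper bound
  \<open>\<bar>\<Gamma>(a + it)\<bar> \<lesssim> (1 + \<bar>t\<bar>) powr (a - 1/2) * exp (- \<pi> \<bar>t\<bar> / 2)\<close> shows that the integrand is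
  \<open>\<lesssim> c powr (n\<sigma> - n/2 + j) * x powr (- n\<sigma> - j)\<close> for \<open>\<bar>t\<bar> \<le> 2c\<close> and exponentially smaller
  further out. Integration costs another factor \<open>c\<close>, which \<open>n \<ge> 2\<close> absorbs; a large \<open>\<sigma>\<close> gives
  the claim.

  The exponent \<open>a - 1/2\<close> has to be exact. It is obtained without Stirling's formula from the values
  on \<open>Re s = 1/2\<close>, because \<open>a \<mapsto> ln \<bar>\<Gamma>(a + it) / \<Gamma>(a)\<bar>\<close> is concave.
\<close>

section \<open>The Gamma function on vertical lines\<close>

text \<open>The exponents are tight. At \<open>x = c\<close> the estimate must stay bounded as
  \<open>c\<close> grows, so no power of \<open>c\<close> may be left unmatched by \<open>x\<close>.
  For \<open>n = 2\<close> the gain of \<open>n/2\<close> in the exponent of \<open>c\<close> is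
  exactly used up by the integration, and a Gamma bound that loses a power of 1 + |t| would fail.
  Since the \<lambda>'s sum to 0, the n Gamma exponents add up to n\<sigma> - n/2. Their real parts
  are controlled by those of \<nu>, so that \<sigma> can be chosen from r and M alone; the imaginary
  parts, at most 2c in size, enter only through \<open>c\<close>. The concavity comes from Euler's
  limit formula: |Gamma(a + it) / Gamma(a)|^2 is the product over k of 1 / (1 + t^2 / (a + k)^2),
  and u -> ln (1 + t^2 / u^2) is convex for u > 0. A concave function grows beyond m at most with
  its slope over [m - 1, m], and the functional equation makes this slope explicit: it is ln |1 + it
  / (m - 1)|, so each unit step in a costs one factor of size about |t|.\<close>

lemma convex_on_ln_one_plus_square_ratio:
  fixes t :: real
  shows "convex_on {0<..} (\<lambda>u. ln (1 + t\<^sup>2 / u\<^sup>2))"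
proof (rule convex_on_realI)
  show "connected {0::real<..}" by simp
  show "((\<lambda>u. ln (1 + t\<^sup>2 / u\<^sup>2)) has_real_derivative (- 2 * t\<^sup>2 / (u * (u\<^sup>2 + t\<^sup>2)))) (at u)"
    if "u \<in> {0<..}" for u
  proof -
    have u: "u > 0" and p: "1 + t\<^sup>2 / u\<^sup>2 > 0" "u\<^sup>2 + t\<^sup>2 > 0"
      using that by (auto intro!: add_pos_nonneg)
    have e: "1 + t\<^sup>2 / u\<^sup>2 = (u\<^sup>2 + t\<^sup>2) / u\<^sup>2" using u by (simp add: field_simps)
    have "((\<lambda>u. ln (1 + t\<^sup>2 / u\<^sup>2)) has_real_derivative
        (- (2 * t\<^sup>2 * u) / (u\<^sup>2 * u\<^sup>2)) / (1 + t\<^sup>2 / u\<^sup>2)) (at u)"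
      using u p by (auto intro!: derivative_eq_intros simp: power2_eq_square mult_ac)
    also have "(- (2 * t\<^sup>2 * u) / (u\<^sup>2 * u\<^sup>2)) / (1 + t\<^sup>2 / u\<^sup>2) = - 2 * t\<^sup>2 / (u * (u\<^sup>2 + t\<^sup>2))"
      unfolding e using u p(2) by (simp add: divide_simps power2_eq_square)
    finally show ?thesis .
  qed
  show "- 2 * t\<^sup>2 / (u * (u\<^sup>2 + t\<^sup>2)) \<le> - 2 * t\<^sup>2 / (v * (v\<^sup>2 + t\<^sup>2))"
    if "u \<in> {0<..}" "v \<in> {0<..}" "u \<le> v" for u v
  proof -
    have "2 * t\<^sup>2 / (v * (v\<^sup>2 + t\<^sup>2)) \<le> 2 * t\<^sup>2 / (u * (u\<^sup>2 + t\<^sup>2))"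
    proof (rule divide_left_mono)
      show "u * (u\<^sup>2 + t\<^sup>2) \<le> v * (v\<^sup>2 + t\<^sup>2)"
        using that by (intro mult_mono add_right_mono power_mono) auto
      show "0 < v * (v\<^sup>2 + t\<^sup>2) * (u * (u\<^sup>2 + t\<^sup>2))"
        using that by (intro mult_pos_pos add_pos_nonneg) auto
    qed simp
    then show ?thesis by simp
  qed
qed

text \<open>By convexity the chord over [u - 1, u], prolonged to the right, stays below the graph.
  The unit length of the chord is what makes the slopes telescope when such bounds are summed;
  \<open>1 < u\<close> keeps its left end in the domain of convexity.\<close>

lemma ln_square_ratio_extrapolate:
  fixes t u w :: real
  defines "h \<equiv> \<lambda>u. ln (1 + t\<^sup>2 / u\<^sup>2)"
  assumes u: "1 < u" and w: "u \<le> w"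
  shows "h u + (w - u) * (h u - h (u - 1)) \<le> h w"
proof -
  \<comment> \<open>The length of [u - 1, w]: the point u divides this interval with weights 1 - 1/D
    and 1/D.\<close>
  define D where "D = w - u + 1"
  have D: "D > 0" using w by (simp add: D_def)
  have "h ((1 - 1 / D) *\<^sub>R (u - 1) + (1 / D) *\<^sub>R w) \<le> (1 - 1 / D) * h (u - 1) + (1 / D) * h w"
    using convex_on_ln_one_plus_square_ratio[of t] D u w unfolding h_def
    by (intro convex_onD) (auto simp: D_def)
  also have "(1 - 1 / D) *\<^sub>R (u - 1) + (1 / D) *\<^sub>R w = u"
    using D by (simp add: field_simps) (simp add: D_def algebra_simps)
  finally have "D * h u \<le> D * ((1 - 1 / D) * h (u - 1) + (1 / D) * h w)"
    using D by (intro mult_left_mono) auto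
  also have "\<dots> = (D - 1) * h (u - 1) + h w" using D by (simp add: field_simps)
  finally show ?thesis by (simp add: D_def algebra_simps)
qed

text \<open>Extrapolating the k-th term from the chord over [m + k - 1, m + k] gives slopes that
  telescope to \<open>h (m + N) - h (m - 1)\<close>. The first of these is nonnegative and is
  dropped, so the loss does not depend on N and survives the limit.\<close>

lemma sum_ln_square_ratio_ge:
  fixes t a m :: real
  defines "h \<equiv> \<lambda>u. ln (1 + t\<^sup>2 / u\<^sup>2)"
  assumes m: "1 < m" and a: "m \<le> a"
  shows "(\<Sum>k\<le>N. h (m + real k)) - (a - m) * h (m - 1) \<le> (\<Sum>k\<le>N. h (a + real k))"
proof -
  have h0: "h u \<ge> 0" for u by (simp add: h_def)
  have "(\<Sum>k\<le>N. h (m + real k)) + (a - m) * (h (m + real N) - h (m - 1)) \<le> (\<Sum>k\<le>N. h (a + real k))"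
  proof (induction N)
    case 0
    show ?case using ln_square_ratio_extrapolate[of m a t] m a by (simp add: h_def)
  next
    case (Suc N)
    have "h (m + real (Suc N)) + (a - m) * (h (m + real (Suc N)) - h (m + real N)) \<le> h (a + real (Suc N))"
      using ln_square_ratio_extrapolate[of "m + real (Suc N)" "a + real (Suc N)" t] m a
      by (simp add: h_def)
    with Suc show ?case by (simp add: algebra_simps)
  qed
  moreover have "(a - m) * h (m + real N) \<ge> 0" using h0 a by simp
  ultimately show ?thesis by (simp add: algebra_simps)
qed

text \<open>The numerator of Euler's approximant has a norm that depends only on the real part; in
  the denominator |a + k + it| is (a + k) times the square root of 1 + t^2 / (a + k)^2.\<close>

lemma norm_Gamma_series_ratio:
  fixes a t :: real
  assumes a: "a > 0" and N: "N > 0"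
  shows "norm (Gamma_series (Complex a t) N) =
    Gamma_series a N * exp (- (\<Sum>k\<le>N. ln (1 + t\<^sup>2 / (a + real k)\<^sup>2)) / 2)"
proof -
  have n: "norm (Complex a t + of_nat k) = (a + real k) * exp (ln (1 + t\<^sup>2 / (a + real k)\<^sup>2) / 2)" for k
  proof -
    have p: "a + real k > 0" "1 + t\<^sup>2 / (a + real k)\<^sup>2 > 0" using a by (auto intro!: add_pos_nonneg)
    have "exp (ln (1 + t\<^sup>2 / (a + real k)\<^sup>2) / 2) = sqrt (1 + t\<^sup>2 / (a + real k)\<^sup>2)"
      using p by (simp add: powr_def flip: powr_half_sqrt)
    moreover have "norm (Complex a t + of_nat k) = sqrt ((a + real k)\<^sup>2 * (1 + t\<^sup>2 / (a + real k)\<^sup>2))"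
      using p by (simp add: cmod_def field_simps)
    ultimately show ?thesis using p by (simp add: real_sqrt_mult)
  qed
  have "norm (pochhammer (Complex a t) (Suc N)) = (\<Prod>k\<le>N. norm (Complex a t + of_nat k))"
    by (simp add: pochhammer_prod prod_norm atLeastLessThanSuc_atLeastAtMost atLeast0AtMost)
  also have "\<dots> = pochhammer a (Suc N) * exp ((\<Sum>k\<le>N. ln (1 + t\<^sup>2 / (a + real k)\<^sup>2)) / 2)"
    unfolding n prod.distrib
    by (simp add: pochhammer_prod exp_sum sum_divide_distrib atLeastLessThanSuc_atLeastAtMost atLeast0AtMost)
  finally have P: "norm (pochhammer (Complex a t) (N + 1)) =
     pochhammer a (N + 1) * exp ((\<Sum>k\<le>N. ln (1 + t\<^sup>2 / (a + real k)\<^sup>2)) / 2)" by simp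
  show ?thesis
    unfolding Gamma_series_def norm_divide norm_mult P
    by (simp add: exp_minus field_simps)
qed

text \<open>The extrapolation bound for the finite sums is exponentiated and passed to the limit in
  N. The power of 1 + t^2 / (m - 1)^2 is the exponential of the telescoped slope times a - m; the
  factor 1/2 comes from the square root in the norm.\<close>

lemma norm_Gamma_extrapolate:
  fixes a m t :: real
  assumes m: "1 < m" and a: "m \<le> a"
  shows "norm (Gamma (Complex a t)) \<le>
    Gamma a / Gamma m * (1 + t\<^sup>2 / (m - 1)\<^sup>2) powr ((a - m) / 2) * norm (Gamma (Complex m t))"
proof (rule LIMSEQ_le)
  let ?h = "\<lambda>u. ln (1 + t\<^sup>2 / u\<^sup>2)"
  let ?c = "(1 + t\<^sup>2 / (m - 1)\<^sup>2) powr ((a - m) / 2)"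
  show "(\<lambda>N. norm (Gamma_series (Complex a t) N)) \<longlonglongrightarrow> norm (Gamma (Complex a t))"
    by (intro tendsto_norm Gamma_series_LIMSEQ)
  show "(\<lambda>N. Gamma_series a N / Gamma_series m N * ?c * norm (Gamma_series (Complex m t) N)) \<longlonglongrightarrow>
     Gamma a / Gamma m * ?c * norm (Gamma (Complex m t))"
    using Gamma_real_pos[of m] m by (intro tendsto_intros Gamma_series_LIMSEQ) linarith
  have pos: "Gamma_series b N > 0" if "b > 0" for b :: real and N
    using that by (simp add: Gamma_series_def pochhammer_pos)
  have "norm (Gamma_series (Complex a t) N) \<le>
        Gamma_series a N / Gamma_series m N * ?c * norm (Gamma_series (Complex m t) N)" if N: "N \<ge> 1" for N
  proof -
    have "0 < 1 + t\<^sup>2 / (m - 1)\<^sup>2" by (intro add_pos_nonneg) auto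
    then have c: "?c = exp ((a - m) * ?h (m - 1) / 2)"
      using m by (auto simp: powr_def)
    have "exp (- (\<Sum>k\<le>N. ?h (a + real k)) / 2) \<le> exp ((a - m) * ?h (m - 1) / 2 + - (\<Sum>k\<le>N. ?h (m + real k)) / 2)"
      using sum_ln_square_ratio_ge[OF m a, of t N] by simp
    then have "exp (- (\<Sum>k\<le>N. ?h (a + real k)) / 2) \<le> ?c * exp (- (\<Sum>k\<le>N. ?h (m + real k)) / 2)"
      unfolding c exp_add .
    then have "Gamma_series a N * exp (- (\<Sum>k\<le>N. ?h (a + real k)) / 2) \<le>
       Gamma_series a N * (?c * exp (- (\<Sum>k\<le>N. ?h (m + real k)) / 2))"
      using pos[of a N] m a by (intro mult_left_mono) auto
    then show ?thesis
      using pos[of m N] m a N by (simp add: norm_Gamma_series_ratio)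
  qed
  then show "\<exists>N0. \<forall>N\<ge>N0. norm (Gamma_series (Complex a t) N) \<le>
        Gamma_series a N / Gamma_series m N * ?c * norm (Gamma_series (Complex m t) N)" by blast
qed

text \<open>On Re z = 1/2 the reflected point 1 - z is the conjugate of z, so the reflection formula
  evaluates |Gamma z|^2 exactly, as \<pi> / cosh (\<pi> t).\<close>

lemma norm_Gamma_half_le:
  "norm (Gamma (Complex (1/2) t)) \<le> sqrt (2 * pi) * exp (- pi * \<bar>t\<bar> / 2)"
proof -
  define z where "z = Complex (1/2) t"
  have "of_real ((norm (Gamma z))\<^sup>2) = Gamma z * Gamma (cnj z)"
    by (simp only: complex_norm_square cnj_Gamma)
  also have "cnj z = 1 - z" by (simp add: z_def complex_eq_iff)
  also have "Gamma z * Gamma (1 - z) = of_real pi / sin (of_real pi * z)"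
    by (rule Gamma_reflection_complex)
  also have "of_real pi * z = of_real (pi / 2) + \<i> * of_real (pi * t)"
    by (simp add: z_def complex_eq_iff)
  also have "sin \<dots> = of_real (cosh (pi * t))"
    unfolding sin_add sin_of_real cos_of_real sin_pi_half cos_pi_half cosh_conv_cos[symmetric]
    by (simp add: cosh_def scaleR_conv_of_real exp_of_real flip: of_real_minus of_real_mult)
  finally have "of_real ((norm (Gamma z))\<^sup>2) = complex_of_real (pi / cosh (pi * t))" by simp
  then have eq: "(norm (Gamma z))\<^sup>2 = pi / cosh (pi * t)"
    unfolding of_real_eq_iff .
  have "exp (pi * \<bar>t\<bar>) / 2 \<le> cosh (pi * t)"
    by (cases "t \<ge> 0") (simp_all add: cosh_def)
  then have "pi / cosh (pi * t) \<le> pi / (exp (pi * \<bar>t\<bar>) / 2)"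
    by (intro divide_left_mono) auto
  also have "\<dots> = (sqrt (2 * pi) * exp (- pi * \<bar>t\<bar> / 2))\<^sup>2"
  proof -
    have "(exp (- pi * \<bar>t\<bar> / 2))\<^sup>2 = exp (- (pi * \<bar>t\<bar>))"
      unfolding exp_double[symmetric] by (rule arg_cong[where f = exp]) simp
    moreover have "(sqrt (2 * pi))\<^sup>2 = 2 * pi" by simp
    ultimately have "(sqrt (2 * pi) * exp (- pi * \<bar>t\<bar> / 2))\<^sup>2 = 2 * pi * exp (- (pi * \<bar>t\<bar>))"
      unfolding power_mult_distrib by metis
    then show ?thesis by (simp add: exp_minus field_simps)
  qed
  finally show ?thesis unfolding eq[symmetric] z_def[symmetric]
    by (rule power2_le_imp_le) auto
qed

text \<open>Extrapolation needs a base line m > 1, while explicit values are known on 1/2; the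
  functional equation carries them to m = 3/2, whence the lower limit for \<open>Re z\<close>. On
  [3/2, A] the real Gamma function is bounded by compactness, so \<open>K\<close> depends on
  \<open>A\<close> alone.\<close>

lemma norm_Gamma_vertical_le:
  obtains K where "K > 0" and "\<And>z. \<lbrakk>3/2 \<le> Re z; Re z \<le> A\<rbrakk> \<Longrightarrow>
    norm (Gamma z) \<le> K * (1 + \<bar>Im z\<bar>) powr (Re z - 1/2) * exp (- pi * \<bar>Im z\<bar> / 2)"
proof -
  have "continuous_on {3/2..A} (Gamma :: real \<Rightarrow> real)"
    by (intro continuous_intros) (auto elim!: nonpos_Ints_cases)
  then have "bounded (Gamma ` {3/2..A} :: real set)"
    by (intro compact_imp_bounded compact_continuous_image) auto
  then obtain B :: real where B: "B > 0" "\<And>a. a \<in> {3/2..A} \<Longrightarrow> norm (Gamma a) \<le> B"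
    unfolding bounded_pos by auto
  define K where "K = B / Gamma (3/2) * 2 powr \<bar>A\<bar> * sqrt (2 * pi)"
  have G: "Gamma (3/2 :: real) > 0" by (rule Gamma_real_pos) simp
  have K: "K > 0" using B G by (simp add: K_def)
  moreover have "norm (Gamma z) \<le> K * (1 + \<bar>Im z\<bar>) powr (Re z - 1/2) * exp (- pi * \<bar>Im z\<bar> / 2)"
    if z: "3/2 \<le> Re z" "Re z \<le> A" for z
  proof -
    define a t where "a = Re z" and "t = Im z"
    have zc: "z = Complex a t" by (simp add: a_def t_def)
    have a: "3/2 \<le> a" "a \<le> A" using z by (auto simp: a_def)
    have "Gamma (Complex (1/2) t + 1) = Complex (1/2) t * Gamma (Complex (1/2) t)"
      by (rule Gamma_plus1) (auto simp: complex_eq_iff elim!: nonpos_Ints_cases)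
    moreover have "Complex (1/2) t + 1 = Complex (3/2) t" by (simp add: complex_eq_iff)
    ultimately have "norm (Gamma (Complex (3/2) t)) = norm (Complex (1/2) t) * norm (Gamma (Complex (1/2) t))"
      by (simp add: norm_mult)
    also have "\<dots> \<le> (1 + \<bar>t\<bar>) * (sqrt (2 * pi) * exp (- pi * \<bar>t\<bar> / 2))"
      using cmod_le[of "Complex (1/2) t"] by (intro mult_mono norm_Gamma_half_le) auto
    finally have 1: "norm (Gamma (Complex (3/2) t)) \<le> (1 + \<bar>t\<bar>) * (sqrt (2 * pi) * exp (- pi * \<bar>t\<bar> / 2))" .
    \<comment> \<open>Here m - 1 = 1/2, so the base is 1 + 4 t^2, at most the square of 2 (1 + |t|);
      the square cancels the halving of the exponent.\<close>
    have "(1 + t\<^sup>2 / (3/2 - 1)\<^sup>2) powr ((a - 3/2) / 2) \<le> ((2 * (1 + \<bar>t\<bar>))\<^sup>2) powr ((a - 3/2) / 2)"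
      using a by (intro powr_mono2) (auto simp: power2_eq_square algebra_simps abs_mult_self_eq)
    also have "\<dots> = ((2 * (1 + \<bar>t\<bar>)) powr 2) powr ((a - 3/2) / 2)"
      by simp
    also have "\<dots> = (2 * (1 + \<bar>t\<bar>)) powr (a - 3/2)"
      unfolding powr_powr by (rule arg_cong2[where f = "(powr)"]) simp_all
    also have "\<dots> = 2 powr (a - 3/2) * (1 + \<bar>t\<bar>) powr (a - 3/2)"
      by (rule powr_mult)
    also have "\<dots> \<le> 2 powr \<bar>A\<bar> * (1 + \<bar>t\<bar>) powr (a - 3/2)"
      using a by (intro mult_right_mono powr_mono) auto
    finally have 2: "(1 + t\<^sup>2 / (3/2 - 1)\<^sup>2) powr ((a - 3/2) / 2) \<le> 2 powr \<bar>A\<bar> * (1 + \<bar>t\<bar>) powr (a - 3/2)" .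
    have "norm (Gamma z) \<le> Gamma a / Gamma (3/2) * (1 + t\<^sup>2 / (3/2 - 1)\<^sup>2) powr ((a - 3/2) / 2) * norm (Gamma (Complex (3/2) t))"
      unfolding zc using a by (intro norm_Gamma_extrapolate) auto
    also have "\<dots> \<le> B / Gamma (3/2) * (2 powr \<bar>A\<bar> * (1 + \<bar>t\<bar>) powr (a - 3/2)) *
        ((1 + \<bar>t\<bar>) * (sqrt (2 * pi) * exp (- pi * \<bar>t\<bar> / 2)))"
      using B(2)[of a] a G B(1)
      by (intro mult_mono divide_right_mono 1 2) (auto intro: Gamma_real_nonneg)
    also have "\<dots> = K * ((1 + \<bar>t\<bar>) powr (a - 3/2) * (1 + \<bar>t\<bar>)) * exp (- pi * \<bar>t\<bar> / 2)"
      by (simp only: K_def mult_ac times_divide_eq_left times_divide_eq_right)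
    \<comment> \<open>The factor 1 + |t| paid for moving from 1/2 to 3/2 is exactly what restores
      the exponent a - 1/2.\<close>
    also have "(1 + \<bar>t\<bar>) powr (a - 3/2) * (1 + \<bar>t\<bar>) = (1 + \<bar>t\<bar>) powr (a - 1/2)"
      using powr_add[of "1 + \<bar>t\<bar>" "a - 3/2" 1] by simp
    finally show ?thesis by (simp add: a_def t_def)
  qed
  ultimately show ?thesis using that by blast
qed

section \<open>The product of Gamma factors\<close>

lemma power_le_fact_mult_exp:
  fixes y :: real
  assumes "y \<ge> 0"
  shows "y ^ k \<le> fact k * exp y"
proof -
  have "(\<Sum>i\<in>{k}. y ^ i /\<^sub>R fact i) \<le> (\<Sum>i. y ^ i /\<^sub>R fact i)"
    using assms by (intro sum_le_suminf summable_exp_generic) auto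
  then have "y ^ k / fact k \<le> exp y" by (simp add: exp_def divide_inverse mult.commute)
  then show ?thesis by (simp add: field_simps)
qed

text \<open>A crude companion of the sharp bound, valid also left of 3/2. It serves only the
  qualitative decay behind contour shifts and differentiation, where the degree \<open>N\<close>
  does not matter. Each |z + k| is at least |Im z| \<ge> 1, so moving z to the right by integers
  does not decrease |Gamma z|, and the sharp bound applies once 3/2 is reached.\<close>

lemma norm_Gamma_strip_le:
  obtains K N where "K > 0" and "\<And>z. \<lbrakk>\<alpha> \<le> Re z; Re z \<le> \<beta>; 1 \<le> \<bar>Im z\<bar>\<rbrakk> \<Longrightarrow>
    norm (Gamma z) \<le> K * (1 + \<bar>Im z\<bar>) ^ N * exp (- pi * \<bar>Im z\<bar> / 2)"
proof -
  define m where "m = nat \<lceil>3/2 - \<alpha>\<rceil>"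
  have m: "3/2 \<le> \<alpha> + real m" unfolding m_def by linarith
  obtain K where K: "K > 0" "\<And>z. \<lbrakk>3/2 \<le> Re z; Re z \<le> \<beta> + real m\<rbrakk> \<Longrightarrow>
    norm (Gamma z) \<le> K * (1 + \<bar>Im z\<bar>) powr (Re z - 1/2) * exp (- pi * \<bar>Im z\<bar> / 2)"
    using norm_Gamma_vertical_le[where A = "\<beta> + real m"] by blast
  define N where "N = nat \<lceil>\<beta> + real m\<rceil>"
  have "norm (Gamma z) \<le> K * (1 + \<bar>Im z\<bar>) ^ N * exp (- pi * \<bar>Im z\<bar> / 2)"
    if z: "\<alpha> \<le> Re z" "Re z \<le> \<beta>" "1 \<le> \<bar>Im z\<bar>" for z
  proof -
    have nz: "z \<notin> \<int>\<^sub>\<le>\<^sub>0" using z(3) by (auto elim!: nonpos_Ints_cases)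
    then have G: "Gamma z \<noteq> 0" by (simp add: Gamma_eq_zero_iff)
    have "1 \<le> (\<Prod>k = 0..<m. norm (z + of_nat k))"
    proof (rule prod_ge_1)
      fix k show "1 \<le> norm (z + of_nat k)"
        using abs_Im_le_cmod[of "z + of_nat k"] z(3) by simp
    qed
    then have "1 \<le> norm (pochhammer z m)" by (simp add: pochhammer_prod prod_norm)
    also have "pochhammer z m = Gamma (z + of_nat m) / Gamma z"
      using nz by (rule pochhammer_Gamma)
    finally have "norm (Gamma z) \<le> norm (Gamma (z + of_nat m))"
      using G by (simp add: norm_divide field_simps)
    also have "\<dots> \<le> K * (1 + \<bar>Im z\<bar>) powr (Re z + real m - 1/2) * exp (- pi * \<bar>Im z\<bar> / 2)"
      using K(2)[of "z + of_nat m"] m z by simp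
    also have "(1 + \<bar>Im z\<bar>) powr (Re z + real m - 1/2) \<le> (1 + \<bar>Im z\<bar>) powr real N"
      using z unfolding N_def by (intro powr_mono) linarith+
    also have "(1 + \<bar>Im z\<bar>) powr real N = (1 + \<bar>Im z\<bar>) ^ N"
      by (rule powr_realpow) linarith
    finally show ?thesis using K(1) by (simp add: mult_left_mono mult_right_mono)
  qed
  with K(1) show ?thesis using that by blast
qed

lemma norm_e_fun_sign: "norm (e_fun (of_int \<sigma> * z / 4)) = exp (- pi * (of_int \<sigma> * Im z) / 2)"
  by (simp add: e_fun_def)

text \<open>The decay of Gamma and the factor \<open>e_fun\<close> have the same rate \<pi>/2: they
  cancel when \<sigma> t \<le> 0 and double up when \<sigma> t > 0.\<close>

lemma exp_half_mult_exp_sign: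
  assumes "\<sigma> \<in> {1, -1::int}"
  shows "exp (- pi * \<bar>t\<bar> / 2) * exp (- pi * (of_int \<sigma> * t) / 2) = exp (- pi * max 0 (of_int \<sigma> * t))"
proof -
  have "- pi * \<bar>t\<bar> / 2 + - pi * (of_int \<sigma> * t) / 2 = - pi * max 0 (of_int \<sigma> * t)"
    using assms by (auto simp: max_def abs_if algebra_simps)
  then show ?thesis by (simp flip: exp_add)
qed

text \<open>All factors are at most 1, so a single one bounds the product: that of \<open>p\<close>
  for t \<ge> 0 and that of \<open>q\<close> for t < 0. The shift by \<open>b l\<close> costs at
  most \<open>L\<close>.\<close>

lemma prod_exp_sign_le:
  fixes \<sigma>s :: "nat \<Rightarrow> int" and b :: "nat \<Rightarrow> real"
  assumes p: "p \<in> {1..n}" "\<sigma>s p = 1" and q: "q \<in> {1..n}" "\<sigma>s q = -1"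
    and L: "\<And>l. l \<in> {1..n} \<Longrightarrow> \<bar>b l\<bar> \<le> L"
  shows "(\<Prod>l = 1..n. exp (- pi * max 0 (of_int (\<sigma>s l) * (t - b l)))) \<le> exp (- pi * max 0 (\<bar>t\<bar> - L))"
proof -
  let ?f = "\<lambda>l. exp (- pi * max 0 (of_int (\<sigma>s l) * (t - b l)))"
  have le: "(\<Prod>l = 1..n. ?f l) \<le> ?f r" if "r \<in> {1..n}" for r
  proof -
    have "(\<Prod>l = 1..n. ?f l) = ?f r * (\<Prod>l \<in> {1..n} - {r}. ?f l)"
      using that by (intro prod.remove) auto
    also have "\<dots> \<le> ?f r * 1"
      by (intro mult_left_mono prod_le_1) auto
    finally show ?thesis by simp
  qed
  have "\<exists>r\<in>{1..n}. \<bar>t\<bar> - L \<le> of_int (\<sigma>s r) * (t - b r)"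
  proof (cases "t \<ge> 0")
    case True
    then show ?thesis using p L[OF p(1)] by (intro bexI[of _ p]) auto
  next
    case False
    then show ?thesis using q L[OF q(1)] by (intro bexI[of _ q]) auto
  qed
  then obtain r where r: "r \<in> {1..n}" "\<bar>t\<bar> - L \<le> of_int (\<sigma>s r) * (t - b r)" by blast
  have "?f r \<le> exp (- pi * max 0 (\<bar>t\<bar> - L))"
    using r(2) by (simp add: max.coboundedI2)
  with le[OF r(1)] show ?thesis by linarith
qed

text \<open>The constant is fixed before n, \<lambda>, the signs and \<open>L\<close>, which is the
  uniformity that the final estimate rests on. The Gamma exponents are simply added, after all bases
  have been enlarged to a common one.\<close>

lemma bessel_gamma_factor_bound:
  obtains K where "K > 0" and "\<And>n \<sigma>s lam s L p q. 
    \<lbrakk>\<And>l. l \<in> {1..n} \<Longrightarrow> 3/2 \<le> Re (s - lam l) \<and> Re (s - lam l) \<le> A \<and> \<bar>Im (lam l)\<bar> \<le> L \<and> \<sigma>s l \<in> {1, -1};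
     p \<in> {1..n}; \<sigma>s p = 1; q \<in> {1..n}; \<sigma>s q = -1\<rbrakk> \<Longrightarrow>
    norm (bessel_gamma_factor n \<sigma>s lam s) \<le>
      K ^ n * (1 + \<bar>Im s\<bar> + L) powr (real n * Re s - Re (\<Sum>l = 1..n. lam l) - real n / 2) *
      exp (- pi * max 0 (\<bar>Im s\<bar> - L))"
proof -
  obtain K where K: "K > 0" "\<And>z. \<lbrakk>3/2 \<le> Re z; Re z \<le> A\<rbrakk> \<Longrightarrow>
    norm (Gamma z) \<le> K * (1 + \<bar>Im z\<bar>) powr (Re z - 1/2) * exp (- pi * \<bar>Im z\<bar> / 2)"
    using norm_Gamma_vertical_le by blast
  have "norm (bessel_gamma_factor n \<sigma>s lam s) \<le>
      K ^ n * (1 + \<bar>Im s\<bar> + L) powr (real n * Re s - Re (\<Sum>l = 1..n. lam l) - real n / 2) *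
      exp (- pi * max 0 (\<bar>Im s\<bar> - L))"
    if l: "\<And>l. l \<in> {1..n} \<Longrightarrow> 3/2 \<le> Re (s - lam l) \<and> Re (s - lam l) \<le> A \<and> \<bar>Im (lam l)\<bar> \<le> L \<and> \<sigma>s l \<in> {1, -1}"
      and pq: "p \<in> {1..n}" "\<sigma>s p = 1" "q \<in> {1..n}" "\<sigma>s q = -1"
    for n \<sigma>s lam s L p q
  proof -
    let ?X = "1 + \<bar>Im s\<bar> + L"
    have X: "?X > 0" using l[OF pq(1)] by linarith
    have "norm (bessel_gamma_factor n \<sigma>s lam s) =
        (\<Prod>l = 1..n. norm (Gamma (s - lam l)) * norm (e_fun (of_int (\<sigma>s l) * (s - lam l) / 4)))"
      by (simp add: bessel_gamma_factor_def norm_mult flip: prod_norm)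
    also have "\<dots> \<le> (\<Prod>l = 1..n. K * ?X powr (Re (s - lam l) - 1/2) *
        exp (- pi * max 0 (of_int (\<sigma>s l) * (Im s - Im (lam l)))))"
    proof (rule prod_mono, intro conjI)
      fix i assume i: "i \<in> {1..n}"
      let ?z = "s - lam i"
      have "norm (Gamma ?z) * norm (e_fun (of_int (\<sigma>s i) * ?z / 4)) \<le>
        (K * (1 + \<bar>Im ?z\<bar>) powr (Re ?z - 1/2) * exp (- pi * \<bar>Im ?z\<bar> / 2)) * exp (- pi * (of_int (\<sigma>s i) * Im ?z) / 2)"
        unfolding norm_e_fun_sign using l[OF i] by (intro mult_right_mono K) auto
      also have "\<dots> = K * (1 + \<bar>Im ?z\<bar>) powr (Re ?z - 1/2) * exp (- pi * max 0 (of_int (\<sigma>s i) * Im ?z))"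
        unfolding mult.assoc using exp_half_mult_exp_sign[of "\<sigma>s i" "Im ?z"] l[OF i] by simp
      \<comment> \<open>Enlarging the base is legitimate because the exponent is at least 1, by 3/2
        \<le> Re (s - \<lambda>).\<close>
      also have "\<dots> \<le> K * ?X powr (Re ?z - 1/2) * exp (- pi * max 0 (of_int (\<sigma>s i) * Im ?z))"
        using l[OF i] K(1) by (intro mult_right_mono mult_left_mono powr_mono2) auto
      finally show "norm (Gamma ?z) * norm (e_fun (of_int (\<sigma>s i) * ?z / 4)) \<le> K * ?X powr (Re ?z - 1/2) *
        exp (- pi * max 0 (of_int (\<sigma>s i) * (Im s - Im (lam i))))" by simp
    qed auto
    also have "\<dots> = K ^ n * (\<Prod>l = 1..n. ?X powr (Re (s - lam l) - 1/2)) *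
       (\<Prod>l = 1..n. exp (- pi * max 0 (of_int (\<sigma>s l) * (Im s - Im (lam l)))))"
      by (simp add: prod.distrib)
    also have "(\<Prod>l = 1..n. ?X powr (Re (s - lam l) - 1/2)) = ?X powr (\<Sum>l = 1..n. Re (s - lam l) - 1/2)"
      using X by (simp add: powr_sum)
    also have "(\<Sum>l = 1..n. Re (s - lam l) - 1/2) = real n * Re s - Re (\<Sum>l = 1..n. lam l) - real n / 2"
      by (simp add: sum_subtractf)
    also have "K ^ n * ?X powr (real n * Re s - Re (\<Sum>l = 1..n. lam l) - real n / 2) *
       (\<Prod>l = 1..n. exp (- pi * max 0 (of_int (\<sigma>s l) * (Im s - Im (lam l))))) \<le>
       K ^ n * ?X powr (real n * Re s - Re (\<Sum>l = 1..n. lam l) - real n / 2) *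
      exp (- pi * max 0 (\<bar>Im s\<bar> - L))"
      using pq l K(1) by (intro mult_left_mono prod_exp_sign_le[of p _ _ q]) auto
    finally show ?thesis .
  qed
  with K(1) show ?thesis using that by blast
qed

text \<open>Constants may depend on everything here. Of the rate \<pi> > 3, one unit pays for the
  polynomial growth of the Gamma factors. The remaining rate 2 leaves another unit for the powers of
  s that differentiation in x produces.\<close>

lemma bessel_gamma_factor_strip_decay:
  assumes \<sigma>s: "\<And>l. l \<in> {1..n} \<Longrightarrow> \<sigma>s l \<in> {1, -1}"
    and pq: "p \<in> {1..n}" "\<sigma>s p = 1" "q \<in> {1..n}" "\<sigma>s q = -1"
  obtains C T where "C > 0" "\<And>s. \<lbrakk>\<alpha> \<le> Re s; Re s \<le> \<beta>; T \<le> \<bar>Im s\<bar>\<rbrakk> \<Longrightarrow>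
     norm (bessel_gamma_factor n \<sigma>s lam s) \<le> C * exp (- 2 * \<bar>Im s\<bar>)"
proof -
  define R where "R = (\<Sum>l = 1..n. \<bar>Re (lam l)\<bar>)"
  define L where "L = (\<Sum>l = 1..n. \<bar>Im (lam l)\<bar>)"
  have RL: "\<bar>Re (lam l)\<bar> \<le> R" "\<bar>Im (lam l)\<bar> \<le> L" if "l \<in> {1..n}" for l
    using that unfolding R_def L_def by (auto intro!: member_le_sum)
  have L0: "L \<ge> 0" unfolding L_def by (intro sum_nonneg) auto
  obtain K N where K: "K > 0" "\<And>z. \<lbrakk>\<alpha> - R \<le> Re z; Re z \<le> \<beta> + R; 1 \<le> \<bar>Im z\<bar>\<rbrakk> \<Longrightarrow>
    norm (Gamma z) \<le> K * (1 + \<bar>Im z\<bar>) ^ N * exp (- pi * \<bar>Im z\<bar> / 2)"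
    using norm_Gamma_strip_le by blast
  \<comment> \<open>\<open>exp (1 + L)\<close> is left over from trading the power of 1 + |Im s| + L
    for an exponential, and \<open>exp (pi * L)\<close> from the decay starting only at |Im s| =
    L.\<close>
  define C where "C = K ^ n * fact (N * n) * exp (1 + L + pi * L)"
  have "norm (bessel_gamma_factor n \<sigma>s lam s) \<le> C * exp (- 2 * \<bar>Im s\<bar>)"
    if s: "\<alpha> \<le> Re s" "Re s \<le> \<beta>" "L + 1 \<le> \<bar>Im s\<bar>" for s
  proof -
    let ?X = "1 + \<bar>Im s\<bar> + L"
    have X: "?X > 0" using L0 by linarith
    have "norm (bessel_gamma_factor n \<sigma>s lam s) =
        (\<Prod>l = 1..n. norm (Gamma (s - lam l)) * norm (e_fun (of_int (\<sigma>s l) * (s - lam l) / 4)))"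
      by (simp add: bessel_gamma_factor_def norm_mult flip: prod_norm)
    also have "\<dots> \<le> (\<Prod>l = 1..n. K * ?X ^ N *
        exp (- pi * max 0 (of_int (\<sigma>s l) * (Im s - Im (lam l)))))"
    proof (rule prod_mono, intro conjI)
      fix i assume i: "i \<in> {1..n}"
      let ?z = "s - lam i"
      have z: "\<alpha> - R \<le> Re ?z" "Re ?z \<le> \<beta> + R" "1 \<le> \<bar>Im ?z\<bar>"
        using RL[OF i] s by auto
      have "norm (Gamma ?z) * norm (e_fun (of_int (\<sigma>s i) * ?z / 4)) \<le>
        (K * (1 + \<bar>Im ?z\<bar>) ^ N * exp (- pi * \<bar>Im ?z\<bar> / 2)) * exp (- pi * (of_int (\<sigma>s i) * Im ?z) / 2)"
        unfolding norm_e_fun_sign by (intro mult_right_mono K z) auto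
      also have "\<dots> = K * (1 + \<bar>Im ?z\<bar>) ^ N * exp (- pi * max 0 (of_int (\<sigma>s i) * Im ?z))"
        unfolding mult.assoc using exp_half_mult_exp_sign[of "\<sigma>s i" "Im ?z"] \<sigma>s[OF i] by simp
      also have "\<dots> \<le> K * ?X ^ N * exp (- pi * max 0 (of_int (\<sigma>s i) * Im ?z))"
        using RL[OF i] K(1) by (intro mult_right_mono mult_left_mono power_mono) auto
      finally show "norm (Gamma ?z) * norm (e_fun (of_int (\<sigma>s i) * ?z / 4)) \<le> K * ?X ^ N *
        exp (- pi * max 0 (of_int (\<sigma>s i) * (Im s - Im (lam i))))" by simp
    qed auto
    also have "\<dots> = K ^ n * ?X ^ (N * n) *
       (\<Prod>l = 1..n. exp (- pi * max 0 (of_int (\<sigma>s l) * (Im s - Im (lam l)))))"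
      by (simp add: prod.distrib power_mult power_mult_distrib)
    also have "\<dots> \<le> K ^ n * (fact (N * n) * exp ?X) * exp (- pi * max 0 (\<bar>Im s\<bar> - L))"
      using pq RL K(1) X power_le_fact_mult_exp[of ?X "N * n"]
      by (intro mult_mono mult_left_mono prod_exp_sign_le[of p _ _ q] mult_nonneg_nonneg prod_nonneg) auto
    also have "exp (- pi * max 0 (\<bar>Im s\<bar> - L)) = exp (pi * L) * exp (- pi * \<bar>Im s\<bar>)"
      using s by (simp add: max_def algebra_simps flip: exp_add)
    also have "exp (- pi * \<bar>Im s\<bar>) \<le> exp (- 3 * \<bar>Im s\<bar>)"
      using pi_gt3 by (simp add: mult_right_mono)
    also have "K ^ n * (fact (N * n) * exp ?X) * (exp (pi * L) * exp (- 3 * \<bar>Im s\<bar>)) =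
        K ^ n * fact (N * n) * (exp ?X * exp (pi * L) * exp (- 3 * \<bar>Im s\<bar>))"
      by (simp only: mult_ac)
    also have "exp ?X * exp (pi * L) * exp (- 3 * \<bar>Im s\<bar>) = exp (1 + L + pi * L) * exp (- 2 * \<bar>Im s\<bar>)"
      by (simp flip: exp_add)
    finally show ?thesis using K(1) by (simp add: C_def mult.assoc mult_left_mono)
  qed
  moreover have "C > 0" using K(1) by (simp add: C_def)
  ultimately show ?thesis using that[of C "L + 1"] by blast
qed

section \<open>Moving an upward contour\<close>

lemma has_integral_exp_minus_abs:
  fixes k :: real
  assumes "k > 0"
  shows "((\<lambda>t. exp (- k * \<bar>t\<bar>)) has_integral 2 / k) UNIV"
proof -
  have 1: "((\<lambda>t. exp (- k * \<bar>t\<bar>)) has_integral 1 / k) {0..}"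
    using has_integral_exp_minus_to_infinity[OF assms, of 0]
    by (rule has_integral_eq_rhs[OF has_integral_eq, rotated]) auto
  have "((\<lambda>t. exp (- k * \<bar>-t\<bar>)) absolutely_integrable_on {0..} \<and> integral {0..} (\<lambda>t. exp (- k * \<bar>- t\<bar>)) = 1 / k)"
    using 1 by (simp add: nonnegative_absolutely_integrable_1 has_integral_integrable integral_unique)
  then have "((\<lambda>t. exp (- k * \<bar>t\<bar>)) absolutely_integrable_on {..0} \<and> integral {..0} (\<lambda>t. exp (- k * \<bar>t\<bar>)) = 1 / k)"
    using has_absolute_integral_reflect_real[of "{..0::real}" "{0..}" "\<lambda>t. exp (- k * \<bar>t\<bar>)" "1 / k"] by simp
  then have 2: "((\<lambda>t. exp (- k * \<bar>t\<bar>)) has_integral 1 / k) {..0}"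
    using absolutely_integrable_on_def has_integral_integrable_integral by blast
  have "((\<lambda>t. exp (- k * \<bar>t\<bar>)) has_integral 1 / k + 1 / k) ({0..} \<union> {..0})"
    by (intro has_integral_Un 1 2) (auto intro: negligible_subset[of "{0}"])
  moreover have "{0..} \<union> {..0::real} = UNIV" by auto
  ultimately show ?thesis by simp
qed

text \<open>Contour integrals are taken over paths on [0, 1], so the portion of the contour over
  [-T, T] is rescaled affinely.\<close>

definition truncated_contour :: "(real \<Rightarrow> complex) \<Rightarrow> real \<Rightarrow> real \<Rightarrow> complex" where
  "truncated_contour \<gamma> T = \<gamma> \<circ> (\<lambda>u. (2 * T) *\<^sub>R u + (- T))"

lemma affine_image_atLeastAtMost_01:
  fixes T :: real
  assumes "T > 0"
  shows "(\<lambda>x. 2 * T * x + - T) ` {0..1} = {-T..T}"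
proof -
  have "(\<lambda>x. 2 * T * x + - T) ` {0..1} = {2 * T * 0 + - T..2 * T * 1 + - T}"
    using assms image_affinity_atLeastAtMost[of "2 * T" "- T" 0 1] by auto
  then show ?thesis by simp
qed

lemma truncated_contour_endpoints [simp]:
  "pathstart (truncated_contour \<gamma> T) = \<gamma> (- T)" "pathfinish (truncated_contour \<gamma> T) = \<gamma> T"
  by (simp_all add: truncated_contour_def pathstart_def pathfinish_def)

lemma path_image_truncated_contour:
  assumes "T > 0"
  shows "path_image (truncated_contour \<gamma> T) = \<gamma> ` {-T..T}"
  using affine_image_atLeastAtMost_01[OF assms]
  unfolding path_image_def truncated_contour_def image_comp[symmetric] by simp

lemma valid_path_truncated_contour:
  assumes "\<gamma> piecewise_C1_differentiable_on {-T..T}" "T > 0"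
  shows "valid_path (truncated_contour \<gamma> T)"
  unfolding valid_path_def truncated_contour_def
  by (rule piecewise_C1_differentiable_affine) (use assms affine_image_atLeastAtMost_01 in simp)

lemma has_integral_truncated_contour:
  assumes \<gamma>: "\<gamma> piecewise_C1_differentiable_on {-T..T}" and T: "T > 0"
    and F: "(F has_contour_integral I) (truncated_contour \<gamma> T)"
  shows "((\<lambda>t. F (\<gamma> t) * vector_derivative \<gamma> (at t)) has_integral I) {-T..T}"
proof -
  define h where "h = (\<lambda>t. F (\<gamma> t) * vector_derivative \<gamma> (at t))"
  obtain S where S: "finite S" "\<gamma> C1_differentiable_on ({-T..T} - S)"
    using \<gamma> by (auto simp: piecewise_C1_differentiable_on_def)
  \<comment> \<open>The parameters in [0, 1] at which the contour may have a corner. The chain rule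
    is available only off this finite set, which the integral does not see.\<close>
  define S' where "S' = (\<lambda>t. (t + T) / (2 * T)) ` S"
  have "((\<lambda>u. (2 * T) *\<^sub>R h ((2 * T) *\<^sub>R u + (- T))) has_integral I) {0..1}"
  proof (rule has_integral_spike_finite)
    show "finite S'" unfolding S'_def using S(1) by simp
    show "((\<lambda>u. F (truncated_contour \<gamma> T u) * vector_derivative (truncated_contour \<gamma> T) (at u)) has_integral I) {0..1}"
      using F by (simp add: has_contour_integral)
    show "(2 * T) *\<^sub>R h ((2 * T) *\<^sub>R u + (- T)) = 
        F (truncated_contour \<gamma> T u) * vector_derivative (truncated_contour \<gamma> T) (at u)"
      if u: "u \<in> {0..1} - S'" for u
    proof -
      let ?t = "(2 * T) *\<^sub>R u + (- T)"
      have "?t \<in> (\<lambda>x. 2 * T * x + - T) ` {0..1}" using u by auto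
      then have "?t \<in> {-T..T}" unfolding affine_image_atLeastAtMost_01[OF T] .
      moreover have "?t \<notin> S"
      proof
        assume "?t \<in> S"
        then have "(?t + T) / (2 * T) \<in> S'" unfolding S'_def by blast
        moreover have "(?t + T) / (2 * T) = u" using T by simp
        ultimately show False using u by simp
      qed
      ultimately have "\<gamma> differentiable at ?t" using S(2) unfolding C1_differentiable_on_eq by blast
      then have d: "(\<gamma> has_vector_derivative vector_derivative \<gamma> (at ?t)) (at ?t)"
        by (simp add: vector_derivative_works)
      have "((\<lambda>u. (2 * T) *\<^sub>R u + (- T)) has_vector_derivative (2 * T)) (at u)"
        by (auto intro!: derivative_eq_intros)
      from vector_derivative_at[OF vector_diff_chain_at[OF this d]]
      show ?thesis by (simp add: truncated_contour_def h_def scaleR_conv_of_real)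
    qed
  qed
  from has_integral_cmul[OF this, of "inverse (2 * T)"]
  have "((\<lambda>u. h ((2 * T) *\<^sub>R u + (- T))) has_integral (I /\<^sub>R (2 * T) ^ DIM(real))) {0..1}"
    using T unfolding scaleR_scaleR by simp
  moreover have "cbox ((- T - (- T)) /\<^sub>R (2 * T)) ((T - (- T)) /\<^sub>R (2 * T)) = {0..1}"
    using T by simp
  ultimately have "((\<lambda>u. h ((2 * T) *\<^sub>R u + (- T))) has_integral (I /\<^sub>R (2 * T) ^ DIM(real)))
      (cbox ((- T - (- T)) /\<^sub>R (2 * T)) ((T - (- T)) /\<^sub>R (2 * T)))"
    by simp
  then have "(h has_integral I) (cbox (- T) T)"
    using T by (subst (asm) has_integral_affinity_iff) auto
  then show ?thesis by (simp add: h_def)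
qed

lemma vertical_line_piecewise_C1: "Complex a piecewise_C1_differentiable_on S"
proof -
  have "Complex a = (\<lambda>t. of_real a + \<i> * of_real t)" by (simp add: fun_eq_iff complex_eq_iff)
  then show ?thesis by (auto intro!: derivative_intros)
qed

lemma has_vector_derivative_vertical_line: "(Complex a has_vector_derivative \<i>) (at t)"
proof -
  have "Complex a = (\<lambda>t. of_real a + \<i> * of_real t)" by (simp add: fun_eq_iff complex_eq_iff)
  moreover have "((\<lambda>t. of_real a + \<i> * of_real t) has_vector_derivative \<i>) (at t)"
    by (auto intro!: derivative_eq_intros simp: has_vector_derivative_def scaleR_conv_of_real)
  ultimately show ?thesis by simp
qed

lemma upward_contour_vertical_line: "upward_contour a (Complex a)"
  unfolding upward_contour_def by (auto intro!: exI[of _ 1] vertical_line_piecewise_C1)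

lemma upward_contour_piecewise_C1:
  assumes \<gamma>: "\<gamma> piecewise_C1_differentiable_on {-T0..T0}" and eq: "\<And>t. \<bar>t\<bar> \<ge> T0 \<Longrightarrow> \<gamma> t = Complex a t"
    and T: "0 < T0" "T0 \<le> T"
  shows "\<gamma> piecewise_C1_differentiable_on {-T..T}"
proof -
  have e: "(\<lambda>t. if t \<le> T0 then if t \<le> - T0 then Complex a t else \<gamma> t else Complex a t) = \<gamma>"
    using eq by (auto simp: fun_eq_iff)
  have "(\<lambda>t. if t \<le> T0 then if t \<le> - T0 then Complex a t else \<gamma> t else Complex a t)
          piecewise_C1_differentiable_on {-T..T}"
    by (intro piecewise_C1_differentiable_cases vertical_line_piecewise_C1 \<gamma>) (use T eq in auto)
  then show ?thesis unfolding e .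
qed

lemma vector_derivative_upward_contour:
  assumes eq: "\<And>t. \<bar>t\<bar> \<ge> T0 \<Longrightarrow> \<gamma> t = Complex a t" and t: "\<bar>t\<bar> > T0"
  shows "vector_derivative \<gamma> (at t) = \<i>"
proof (rule vector_derivative_at, rule has_vector_derivative_transform_within_open)
  show "(Complex a has_vector_derivative \<i>) (at t)"
    by (rule has_vector_derivative_vertical_line)
  show "open {t. T0 < \<bar>t\<bar>}" by (intro open_Collect_less continuous_intros)
qed (use eq t in auto)

text \<open>An \<open>integral\<close> over \<open>UNIV\<close> takes a default value when it does
  not exist. Integrability is therefore proved, by comparing the tail with an exponential; the
  truncations then converge to the integral.\<close>

lemma upward_contour_integral:
  assumes \<gamma>: "\<gamma> piecewise_C1_differentiable_on {-T0..T0}" "\<And>t. \<bar>t\<bar> \<ge> T0 \<Longrightarrow> \<gamma> t = Complex a t"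
    and T0: "0 < T0"
    and F: "F holomorphic_on S" "open S" "range \<gamma> \<subseteq> S"
    and decay: "\<And>t. \<bar>t\<bar> \<ge> T1 \<Longrightarrow> norm (F (Complex a t)) \<le> C * exp (- \<bar>t\<bar>)"
  shows "((\<lambda>T. contour_integral (truncated_contour \<gamma> T) F) \<longlongrightarrow>
      integral UNIV (\<lambda>t. F (\<gamma> t) * vector_derivative \<gamma> (at t))) at_top"
proof -
  define h where "h = (\<lambda>t. F (\<gamma> t) * vector_derivative \<gamma> (at t))"
  have T: "(h has_integral contour_integral (truncated_contour \<gamma> T) F) {-T..T}" if "T \<ge> T0" for T
  proof -
    have pc: "\<gamma> piecewise_C1_differentiable_on {-T..T}" and "T > 0"
      using upward_contour_piecewise_C1[OF \<gamma> T0 that] T0 that by auto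
    moreover have "F contour_integrable_on truncated_contour \<gamma> T"
      using \<open>T > 0\<close> F
      by (intro contour_integrable_holomorphic_simple[OF F(1,2)] valid_path_truncated_contour pc)
         (auto simp: path_image_truncated_contour)
    ultimately show ?thesis
      unfolding h_def by (intro has_integral_truncated_contour has_contour_integral_integral)
  qed
  define T2 where "T2 = max T0 T1"
  have int: "h integrable_on cbox u v" for u v
  proof -
    define M where "M = T0 + \<bar>u\<bar> + \<bar>v\<bar>"
    have "h integrable_on cbox (-M) M" using T[of M] by (auto simp: M_def)
    moreover have "cbox u v \<subseteq> cbox (-M) M"
    proof
      fix x assume "x \<in> cbox u v"
      then have "u \<le> x" "x \<le> v" by auto
      then have "-M \<le> x" "x \<le> M" using T0 unfolding M_def by linarith+
      then show "x \<in> cbox (-M) M" by simp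
    qed
    ultimately show ?thesis by (rule integrable_on_subcbox)
  qed
  \<comment> \<open>Piecewise C1 allows the derivative to be unbounded near a corner, while the
    comparison test wants a bound at every point. So the middle portion is split off and only the
    tail \<open>h2\<close> is compared.\<close>
  define h1 where "h1 = (\<lambda>t. if t \<in> cbox (-T2) T2 then h t else 0)"
  have h1: "h1 integrable_on UNIV"
    unfolding h1_def integrable_restrict_UNIV by (rule int)
  define h2 where "h2 = (\<lambda>t. h t - h1 t)"
  have h2: "h2 integrable_on UNIV"
  proof (rule integrable_on_all_intervals_integrable_bound)
    have "h1 integrable_on cbox u v" for u v
      using h1 by (rule integrable_on_subcbox) auto
    then show "(\<lambda>x. if x \<in> UNIV then h2 x else 0) integrable_on cbox u v" for u v
      using integrable_diff[OF int] by (simp add: h2_def)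
    show "norm (h2 t) \<le> \<bar>C\<bar> * exp (- 1 * \<bar>t\<bar>)" for t
    proof (cases "t \<in> cbox (-T2) T2")
      case False
      then have t: "\<bar>t\<bar> > T0" "\<bar>t\<bar> \<ge> T1" by (auto simp: T2_def)
      have "h2 t = h t" using False by (simp only: h2_def h1_def if_False diff_zero)
      then have "norm (h2 t) = norm (F (Complex a t))"
        using t vector_derivative_upward_contour[OF \<gamma>(2) t(1)] \<gamma>(2)[of t]
        by (simp add: h_def norm_mult)
      also have "\<dots> \<le> C * exp (- \<bar>t\<bar>)" using decay t by simp
      also have "\<dots> \<le> \<bar>C\<bar> * exp (- \<bar>t\<bar>)" by (intro mult_right_mono) auto
      finally show ?thesis by simp
    qed (simp add: h2_def h1_def)
    show "(\<lambda>t. \<bar>C\<bar> * exp (- 1 * \<bar>t\<bar>)) integrable_on (UNIV :: real set)"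
      using has_integral_exp_minus_abs[of 1]
      by (intro integrable_on_mult_right has_integral_integrable[where i = "2 / 1"]) simp
  qed
  have "(\<lambda>t. h1 t + h2 t) integrable_on UNIV" using h1 h2 by (rule integrable_add)
  then have "h integrable_on UNIV" by (simp add: h2_def)
  then have H: "(h has_integral integral UNIV h) UNIV" by (rule integrable_integral)
  show ?thesis unfolding h_def[symmetric]
  proof (rule tendstoI)
    fix e :: real assume "e > 0"
    then obtain B where B: "B > 0" "\<And>u v. ball 0 B \<subseteq> cbox u v \<Longrightarrow>
        norm (integral (cbox u v) (\<lambda>x. if x \<in> UNIV then h x else 0) - integral UNIV h) < e"
      using H unfolding has_integral_alt'[of h] by blast
    show "\<forall>\<^sub>F T in at_top. dist (contour_integral (truncated_contour \<gamma> T) F) (integral UNIV h) < e"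
      unfolding eventually_at_top_linorder
    proof (intro exI allI impI)
      fix M assume M: "M \<ge> max B T0"
      have "ball 0 B \<subseteq> cbox (-M) M" using M by (auto simp: dist_real_def)
      from B(2)[OF this] show "dist (contour_integral (truncated_contour \<gamma> M) F) (integral UNIV h) < e"
        using T[of M] M by (simp add: dist_norm integral_unique)
    qed
  qed
qed

text \<open>The range is a compact arc together with two closed vertical rays. Its complement is
  thus open, and there connectedness to the far left yields an actual path.\<close>

lemma closed_range_upward_contour:
  assumes \<gamma>: "\<gamma> piecewise_C1_differentiable_on {-T0..T0}" "\<And>t. \<bar>t\<bar> \<ge> T0 \<Longrightarrow> \<gamma> t = Complex a t"
  shows "closed (range \<gamma>)"
proof -
  have "range \<gamma> = \<gamma> ` {-T0..T0} \<union> {z. Re z = a \<and> Im z \<ge> T0} \<union> {z. Re z = a \<and> Im z \<le> - T0}"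
  proof (intro equalityI subsetI)
    fix z assume "z \<in> range \<gamma>"
    then obtain t where t: "z = \<gamma> t" by blast
    show "z \<in> \<gamma> ` {-T0..T0} \<union> {z. Re z = a \<and> Im z \<ge> T0} \<union> {z. Re z = a \<and> Im z \<le> - T0}"
    proof (cases "t \<in> {-T0..T0}")
      case False
      then show ?thesis using \<gamma>(2)[of t] t by (auto simp: abs_if split: if_splits)
    qed (use t in auto)
  next
    fix z assume "z \<in> \<gamma> ` {-T0..T0} \<union> {z. Re z = a \<and> Im z \<ge> T0} \<union> {z. Re z = a \<and> Im z \<le> - T0}"
    then consider "z \<in> \<gamma> ` {-T0..T0}" | "Re z = a" "\<bar>Im z\<bar> \<ge> T0" by fastforce
    then show "z \<in> range \<gamma>"
    proof cases
      case 2
      then have "z = \<gamma> (Im z)" using \<gamma>(2)[of "Im z"] by (simp add: complex_eq_iff)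
      then show ?thesis by blast
    qed auto
  qed
  moreover have "closed (\<gamma> ` {-T0..T0})"
    using \<gamma>(1) unfolding piecewise_C1_differentiable_on_def
    by (intro compact_imp_closed compact_continuous_image) auto
  moreover have "closed {z. Re z = a \<and> Im z \<ge> T0}" "closed {z. Re z = a \<and> Im z \<le> - T0}"
    by (intro closed_Collect_conj closed_Collect_eq closed_Collect_le continuous_intros)+
  ultimately show ?thesis by (simp add: closed_Un)
qed

text \<open>
  The path from the far left to a pole in the complement of the contour may wander to the right
  of any prescribed vertical line. A line to the right of all these (finitely many relevant)
  paths is not crossed, so the closed-up contour has winding number \<open>0\<close> around each pole.
  Comparing two contours with a common far line then removes the restriction.
\<close>

lemma upward_contour_shift_far:
  assumes \<gamma>: "upward_contour a \<gamma>" "P \<subseteq> left_side \<gamma>"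
    and P: "closed P" "\<And>b. finite {z \<in> P. b \<le> Re z}"
    and F: "F holomorphic_on - P"
    and decay: "\<And>\<alpha> \<beta>. \<exists>C T. \<forall>s. \<alpha> \<le> Re s \<longrightarrow> Re s \<le> \<beta> \<longrightarrow> T \<le> \<bar>Im s\<bar> \<longrightarrow> norm (F s) \<le> C * exp (- \<bar>Im s\<bar>)"
  obtains \<sigma>0 where "\<And>\<sigma>. \<sigma> \<ge> \<sigma>0 \<Longrightarrow>
    integral UNIV (\<lambda>t. F (\<gamma> t) * vector_derivative \<gamma> (at t)) =
    integral UNIV (\<lambda>t. F (Complex \<sigma> t) * vector_derivative (Complex \<sigma>) (at t))"
proof -
  obtain T0 where T0: "T0 > 0" "\<gamma> piecewise_C1_differentiable_on {-T0..T0}"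
      "\<And>t. \<bar>t\<bar> \<ge> T0 \<Longrightarrow> \<gamma> t = Complex a t"
    using \<gamma>(1) unfolding upward_contour_def by blast
  have cont: "continuous_on {-T0..T0} \<gamma>"
    using T0(2) unfolding piecewise_C1_differentiable_on_def by blast
  have op: "open (- range \<gamma>)" using closed_range_upward_contour[OF T0(2,3)] by (rule open_Compl)
  have avoid: "range \<gamma> \<subseteq> - P"
  proof -
    have "z \<notin> range \<gamma>" if "z \<in> P" for z
      using \<gamma>(2) that connected_component_in unfolding left_side_def by blast
    then show ?thesis by blast
  qed
  obtain b0 where b0: "\<And>t. b0 \<le> Re (\<gamma> t)"
  proof -
    have "bounded (\<gamma> ` {-T0..T0})"
      by (intro compact_imp_bounded compact_continuous_image cont) auto
    then obtain B where B: "\<And>t. t \<in> {-T0..T0} \<Longrightarrow> norm (\<gamma> t) \<le> B"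
      unfolding bounded_iff by blast
    show ?thesis
    proof (rule that[of "min a (- B)"])
      fix t show "min a (- B) \<le> Re (\<gamma> t)"
      proof (cases "t \<in> {-T0..T0}")
        case True
        then show ?thesis using B[OF True] abs_Re_le_cmod[of "\<gamma> t"] by linarith
      next
        case False
        then have "T0 \<le> \<bar>t\<bar>" by auto
        then show ?thesis using T0(3) by simp
      qed
    qed
  qed
  \<comment> \<open>The loops below lie in Re s \<ge> \<open>b0\<close>, so poles further left have
    winding number 0 for free. Only the finitely many others need a path.\<close>
  define Q where "Q = {z \<in> P. b0 \<le> Re z}"
  have "\<exists>p b. path p \<and> path_image p \<subseteq> - range \<gamma> \<and> pathstart p = of_real b \<and> pathfinish p = z \<and> (\<forall>t. b < Re (\<gamma> t))"
    if z: "z \<in> Q" for z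
  proof -
    obtain b where b: "\<forall>t. b < Re (\<gamma> t)" "connected_component (- range \<gamma>) (of_real b) z"
      using z \<gamma>(2) unfolding Q_def left_side_def by blast
    then have "path_component (- range \<gamma>) (of_real b) z"
      using open_path_connected_component[OF op] by metis
    then show ?thesis using b(1) unfolding path_component_def by blast
  qed
  then obtain p b where p: "\<And>z. z \<in> Q \<Longrightarrow> path (p z)" "\<And>z. z \<in> Q \<Longrightarrow> path_image (p z) \<subseteq> - range \<gamma>"
      "\<And>z. z \<in> Q \<Longrightarrow> pathstart (p z) = of_real (b z)" "\<And>z. z \<in> Q \<Longrightarrow> pathfinish (p z) = z"
      "\<And>z t. z \<in> Q \<Longrightarrow> b z < Re (\<gamma> t)"
    by metis
  have "bounded (\<Union>z\<in>Q. path_image (p z))"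
    using P(2)[of b0] p(1) by (intro bounded_UN) (auto simp: Q_def bounded_path_image)
  then obtain B where B: "B > 0" "\<And>z w. z \<in> Q \<Longrightarrow> w \<in> path_image (p z) \<Longrightarrow> norm w \<le> B"
    unfolding bounded_pos by blast
  have BQ: "norm z \<le> B" if "z \<in> Q" for z
    using B(2)[OF that, of z] p(4)[OF that] pathfinish_in_path_image[of "p z"] by simp
  \<comment> \<open>Beyond \<open>B\<close> the line misses the disc that contains all the chosen
    paths; \<open>a\<close> is included so that the closing segments run in the strip between
    \<open>a\<close> and \<sigma>.\<close>
  define \<sigma>0 where "\<sigma>0 = max (B + 1) a"
  have "integral UNIV (\<lambda>t. F (\<gamma> t) * vector_derivative \<gamma> (at t)) =
    integral UNIV (\<lambda>t. F (Complex \<sigma> t) * vector_derivative (Complex \<sigma>) (at t))" if \<sigma>: "\<sigma> \<ge> \<sigma>0" for \<sigma>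
  proof -
    have \<sigma>B: "B < \<sigma>" "a \<le> \<sigma>" using \<sigma> by (auto simp: \<sigma>0_def)
    obtain C T1 where CT: "\<And>s. a \<le> Re s \<Longrightarrow> Re s \<le> \<sigma> \<Longrightarrow> T1 \<le> \<bar>Im s\<bar> \<Longrightarrow> norm (F s) \<le> C * exp (- \<bar>Im s\<bar>)"
      using decay[of a \<sigma>] by blast
    have ab0: "b0 \<le> a" using b0[of T0] T0(3)[of T0] T0(1) by simp
    have off: "z \<notin> P" if "b0 \<le> Re z" "norm z > B" for z
      using BQ[of z] that unfolding Q_def by force
    have line: "range (Complex \<sigma>) \<subseteq> - P"
    proof -
      have "Complex \<sigma> t \<notin> P" for t
        using abs_Re_le_cmod[of "Complex \<sigma> t"] \<sigma>B ab0 B(1) by (intro off) auto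
      then show ?thesis by blast
    qed
    define diff where "diff = (\<lambda>T. contour_integral (truncated_contour \<gamma> T) F - contour_integral (truncated_contour (Complex \<sigma>) T) F)"
    have bound: "norm (diff T) \<le> 2 * (C * exp (- T) * (\<sigma> - a))" if T: "T \<ge> T0" "T \<ge> T1" "T > B" for T
    proof -
      have Tpos: "T > 0" using T0(1) T by simp
      have pc: "\<gamma> piecewise_C1_differentiable_on {-T..T}"
        by (rule upward_contour_piecewise_C1[OF T0(2,3,1) T(1)])
      let ?g = "truncated_contour \<gamma> T" and ?l = "truncated_contour (Complex \<sigma>) T"
      let ?u = "linepath (Complex a T) (Complex \<sigma> T)" and ?d = "linepath (Complex a (-T)) (Complex \<sigma> (-T))"
      have ends: "\<gamma> T = Complex a T" "\<gamma> (- T) = Complex a (- T)" using T0(3)[of T] T0(3)[of "-T"] T Tpos by auto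
      have vp: "valid_path ?g" "valid_path ?l"
        using Tpos pc by (auto intro!: valid_path_truncated_contour vertical_line_piecewise_C1)
      have seg: "s \<in> closed_segment (Complex a t) (Complex \<sigma> t) \<Longrightarrow> a \<le> Re s \<and> Re s \<le> \<sigma> \<and> Im s = t" for s t
      proof -
        assume "s \<in> closed_segment (Complex a t) (Complex \<sigma> t)"
        moreover have "closed_segment (Complex a t) (Complex \<sigma> t) \<subseteq> {s. a \<le> Re s} \<inter> {s. Re s \<le> \<sigma>} \<inter> {s. Im s = t}"
          using \<sigma>B by (intro closed_segment_subset convex_Int convex_halfspace_Re_ge convex_halfspace_Re_le)
             (auto simp: convex_def algebra_simps simp flip: distrib_right)
        ultimately show ?thesis by blast
      qed
      have segP: "closed_segment (Complex a t) (Complex \<sigma> t) \<subseteq> - P" if "\<bar>t\<bar> > B" for t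
      proof
        fix s assume "s \<in> closed_segment (Complex a t) (Complex \<sigma> t)"
        from seg[OF this] show "s \<in> - P"
          using that ab0 abs_Im_le_cmod[of s] off[of s] by force
      qed
      have imgs: "path_image ?g = \<gamma> ` {-T..T}" "path_image ?l = Complex \<sigma> ` {-T..T}"
        using Tpos by (simp_all add: path_image_truncated_contour)
      have ig: "(F has_contour_integral contour_integral ?g F) ?g"
        by (intro has_contour_integral_integral contour_integrable_holomorphic_simple[OF F] vp)
           (use P(1) avoid imgs in \<open>auto simp: open_Compl\<close>)
      have il: "(F has_contour_integral contour_integral ?l F) ?l"
        by (intro has_contour_integral_integral contour_integrable_holomorphic_simple[OF F] vp)
           (use P(1) line imgs in \<open>auto simp: open_Compl\<close>)
      have iu: "(F has_contour_integral contour_integral ?u F) ?u"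
        by (intro has_contour_integral_integral contour_integrable_holomorphic_simple[OF F])
           (use P(1) segP[of T] T Tpos in \<open>auto simp: open_Compl\<close>)
      have id: "(F has_contour_integral contour_integral ?d F) ?d"
        by (intro has_contour_integral_integral contour_integrable_holomorphic_simple[OF F])
           (use P(1) segP[of "-T"] T Tpos in \<open>auto simp: open_Compl\<close>)
      \<comment> \<open>Up along the contour, right along height T, down the line Re s = \<sigma>,
        and back left along height -T.\<close>
      define loop where "loop = ?g +++ (?u +++ (reversepath ?l +++ reversepath ?d))"
      have vploop: "valid_path loop"
        unfolding loop_def using vp ends by (intro valid_path_join) auto
      have img: "path_image loop = \<gamma> ` {-T..T} \<union> (closed_segment (Complex a T) (Complex \<sigma> T) \<union>
           (Complex \<sigma> ` {-T..T} \<union> closed_segment (Complex a (-T)) (Complex \<sigma> (-T))))"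
        unfolding loop_def using ends imgs by (simp add: path_image_join closed_segment_commute)
      have closed_loop: "pathfinish loop = pathstart loop" unfolding loop_def using ends by simp
      have right: "b' \<le> Re w" if "w \<in> path_image loop" "\<And>t. b' \<le> Re (\<gamma> t)" for b' w
      proof -
        have "b' \<le> a" using that(2)[of T] ends(1) by simp
        then show ?thesis using that(1,2) \<sigma>B seg[of w] unfolding img by fastforce
      qed
      have "(F has_contour_integral 0) loop"
      proof (rule Cauchy_theorem_global[OF _ F vploop closed_loop])
        show "open (- P)" using P(1) by (rule open_Compl)
        show "path_image loop \<subseteq> - P"
          unfolding img using avoid line segP[of T] segP[of "-T"] T Tpos by auto
        fix w assume "w \<notin> - P"
        then have w: "w \<in> P" by simp
        show "winding_number loop w = 0"
        proof (cases "w \<in> Q")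
          case False
          show ?thesis
            by (rule winding_number_zero_outside[of _ "{s. Re s \<ge> b0}"])
               (use vploop closed_loop right[OF _ b0] False w in
                 \<open>auto simp: valid_path_imp_path convex_halfspace_Re_ge Q_def\<close>)
        next
          case True
          \<comment> \<open>The path from w to the far left avoids the contour by choice, and the
            other three sides because it stays in the disc of radius \<open>B\<close> while \<sigma>
            and T exceed \<open>B\<close>. Hence the winding number is constant along it, and at its
            other end the whole loop lies to the right.\<close>
          have "winding_number loop w = winding_number loop (of_real (b w))"
          proof (rule winding_number_eq[of _ _ "path_image (p w)"])
            show "w \<in> path_image (p w)" "of_real (b w) \<in> path_image (p w)"
              using p(3,4)[OF True] pathfinish_in_path_image[of "p w"] pathstart_in_path_image[of "p w"] by auto
            have "z \<notin> path_image loop" if z: "z \<in> path_image (p w)" for z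
            proof -
              have "\<bar>Re z\<bar> \<le> B" "\<bar>Im z\<bar> \<le> B"
                using B(2)[OF True z] abs_Re_le_cmod[of z] abs_Im_le_cmod[of z] by linarith+
              moreover have "z \<notin> range \<gamma>" using p(2)[OF True] z by blast
              ultimately show ?thesis unfolding img using seg[of z T] seg[of z "-T"] T \<sigma>B by auto
            qed
            then show "path_image (p w) \<inter> path_image loop = {}" by blast
          qed (use vploop closed_loop p(1)[OF True] in \<open>auto simp: valid_path_imp_path connected_path_image\<close>)
          also have "winding_number loop (of_real (b w)) = 0"
          proof (rule winding_number_zero_outside[of _ "{s. Re s > b w}"])
            show "path_image loop \<subseteq> {s. b w < Re s}"
            proof
              fix z assume z: "z \<in> path_image loop"
              have "b w < a" using p(5)[OF True, of T] ends(1) by simp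
              with z show "z \<in> {s. b w < Re s}"
                using p(5)[OF True] \<sigma>B seg[of z] unfolding img by fastforce
            qed
          qed (use vploop closed_loop in \<open>auto simp: valid_path_imp_path convex_halfspace_Re_gt\<close>)
          finally show ?thesis .
        qed
      qed
      moreover have "(F has_contour_integral (contour_integral ?g F + (contour_integral ?u F +
           (- contour_integral ?l F + - contour_integral ?d F)))) loop"
        unfolding loop_def using vp ends
        by (intro has_contour_integral_join has_contour_integral_reversepath ig il iu id valid_path_join) auto
      ultimately have "contour_integral ?g F + (contour_integral ?u F +
           (- contour_integral ?l F + - contour_integral ?d F)) = 0"
        by (rule has_contour_integral_unique[symmetric])
      then have "diff T = contour_integral ?d F - contour_integral ?u F"
        unfolding diff_def by (simp add: algebra_simps)
      then have "norm (diff T) \<le> norm (contour_integral ?d F) + norm (contour_integral ?u F)"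
        by (simp add: norm_triangle_ineq4)
      also have "norm (contour_integral ?d F) \<le> C * exp (- T) * norm (Complex \<sigma> (-T) - Complex a (-T))"
      proof (rule has_contour_integral_bound_linepath[OF id])
        show "norm (F s) \<le> C * exp (- T)" if "s \<in> closed_segment (Complex a (-T)) (Complex \<sigma> (-T))" for s
          using seg[OF that] CT[of s] T Tpos by simp
        \<comment> \<open>The sign of \<open>C\<close> is not known, but the bound dominates a norm
          at an endpoint.\<close>
        from this[of "Complex a (-T)"] show "0 \<le> C * exp (- T)"
          using norm_ge_zero[of "F (Complex a (-T))"] by (meson ends_in_segment(1) order_trans)
      qed
      also have "norm (contour_integral ?u F) \<le> C * exp (- T) * norm (Complex \<sigma> T - Complex a T)"
      proof (rule has_contour_integral_bound_linepath[OF iu])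
        show "norm (F s) \<le> C * exp (- T)" if "s \<in> closed_segment (Complex a T) (Complex \<sigma> T)" for s
          using seg[OF that] CT[of s] T Tpos by simp
        from this[of "Complex a T"] show "0 \<le> C * exp (- T)"
          using norm_ge_zero[of "F (Complex a T)"] by (meson ends_in_segment(1) order_trans)
      qed
      moreover have "norm (Complex \<sigma> t - Complex a t) = \<sigma> - a" for t
        using \<sigma>B by (simp add: cmod_def)
      ultimately show ?thesis by simp
    qed
    have "(diff \<longlongrightarrow> 0) at_top"
    proof (rule Lim_null_comparison)
      show "\<forall>\<^sub>F T in at_top. norm (diff T) \<le> 2 * (C * exp (- T) * (\<sigma> - a))"
        using eventually_ge_at_top[of T0] eventually_ge_at_top[of T1] eventually_gt_at_top[of B]
        by eventually_elim (rule bound)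
      have "((\<lambda>T::real. exp (- T)) \<longlongrightarrow> 0) at_top"
        by (rule filterlim_compose[OF exp_at_bot filterlim_uminus_at_bot_at_top])
      from tendsto_mult_right_zero[OF this, of "2 * C * (\<sigma> - a)"]
      show "((\<lambda>T. 2 * (C * exp (- T) * (\<sigma> - a))) \<longlongrightarrow> 0) at_top"
        by (simp add: algebra_simps)
    qed
    moreover have "(diff \<longlongrightarrow> integral UNIV (\<lambda>t. F (\<gamma> t) * vector_derivative \<gamma> (at t)) -
        integral UNIV (\<lambda>t. F (Complex \<sigma> t) * vector_derivative (Complex \<sigma>) (at t))) at_top"
      unfolding diff_def
    proof (intro tendsto_diff)
      show "((\<lambda>T. contour_integral (truncated_contour \<gamma> T) F) \<longlongrightarrow> integral UNIV (\<lambda>t. F (\<gamma> t) * vector_derivative \<gamma> (at t))) at_top"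
        by (rule upward_contour_integral[OF T0(2,3,1) F open_Compl[OF P(1)] avoid, of T1 C])
           (use CT[of "Complex a _"] \<sigma>B in auto)
      show "((\<lambda>T. contour_integral (truncated_contour (Complex \<sigma>) T) F) \<longlongrightarrow>
          integral UNIV (\<lambda>t. F (Complex \<sigma> t) * vector_derivative (Complex \<sigma>) (at t))) at_top"
        by (rule upward_contour_integral[OF vertical_line_piecewise_C1 refl T0(1) F open_Compl[OF P(1)] line, of T1 C])
           (use CT[of "Complex \<sigma> _"] \<sigma>B in auto)
    qed
    ultimately show ?thesis using tendsto_unique[OF trivial_limit_at_top_linorder] by fastforce
  qed
  then show ?thesis using that by blast
qed

lemma upward_contour_shift:
  assumes \<gamma>: "upward_contour a \<gamma>" "P \<subseteq> left_side \<gamma>"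
    and P: "closed P" "\<And>b. finite {z \<in> P. b \<le> Re z}"
    and F: "F holomorphic_on - P"
    and decay: "\<And>\<alpha> \<beta>. \<exists>C T. \<forall>s. \<alpha> \<le> Re s \<longrightarrow> Re s \<le> \<beta> \<longrightarrow> T \<le> \<bar>Im s\<bar> \<longrightarrow> norm (F s) \<le> C * exp (- \<bar>Im s\<bar>)"
    and \<sigma>: "\<And>z. z \<in> P \<Longrightarrow> Re z < \<sigma>"
  shows "integral UNIV (\<lambda>t. F (\<gamma> t) * vector_derivative \<gamma> (at t)) = \<i> * integral UNIV (\<lambda>t. F (Complex \<sigma> t))"
proof -
  obtain \<sigma>1 where 1: "\<And>\<sigma>'. \<sigma>' \<ge> \<sigma>1 \<Longrightarrow>
    integral UNIV (\<lambda>t. F (\<gamma> t) * vector_derivative \<gamma> (at t)) =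
    integral UNIV (\<lambda>t. F (Complex \<sigma>' t) * vector_derivative (Complex \<sigma>') (at t))"
    using upward_contour_shift_far[OF \<gamma> P F decay] by blast
  \<comment> \<open>For a vertical line, segments in the half-plane Re s < \<sigma> already reach
    every pole, so the line qualifies as a contour in its own right.\<close>
  have "P \<subseteq> left_side (Complex \<sigma>)"
  proof
    fix z assume z: "z \<in> P"
    define b where "b = \<sigma> - 1"
    have "closed_segment (of_real b) z \<subseteq> {s. Re s < \<sigma>}"
      using \<sigma>[OF z] by (intro closed_segment_subset convex_halfspace_Re_lt) (auto simp: b_def)
    also have "\<dots> \<subseteq> - range (Complex \<sigma>)" by auto
    finally have "connected_component (- range (Complex \<sigma>)) (of_real b) z"
      unfolding connected_component_def by (intro exI[of _ "closed_segment (of_real b) z"]) auto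
    then show "z \<in> left_side (Complex \<sigma>)"
      unfolding left_side_def by (auto intro!: exI[of _ b] simp: b_def)
  qed
  then obtain \<sigma>2 where 2: "\<And>\<sigma>'. \<sigma>' \<ge> \<sigma>2 \<Longrightarrow>
    integral UNIV (\<lambda>t. F (Complex \<sigma> t) * vector_derivative (Complex \<sigma>) (at t)) =
    integral UNIV (\<lambda>t. F (Complex \<sigma>' t) * vector_derivative (Complex \<sigma>') (at t))"
    using upward_contour_shift_far[OF upward_contour_vertical_line _ P F decay] by blast
  have "integral UNIV (\<lambda>t. F (\<gamma> t) * vector_derivative \<gamma> (at t)) =
      integral UNIV (\<lambda>t. F (Complex \<sigma> t) * vector_derivative (Complex \<sigma>) (at t))"
    using 1[of "max \<sigma>1 \<sigma>2"] 2[of "max \<sigma>1 \<sigma>2"] by simp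
  also have "\<dots> = integral UNIV (\<lambda>t. F (Complex \<sigma> t) * \<i>)"
    by (simp add: vector_derivative_at[OF has_vector_derivative_vertical_line])
  finally show ?thesis by (simp add: mult.commute)
qed

section \<open>Differentiation under the integral\<close>

definition exp_decaying :: "(real \<Rightarrow> complex) \<Rightarrow> bool" where
  "exp_decaying q \<longleftrightarrow> continuous_on UNIV q \<and>
     (\<forall>k. \<exists>C. \<forall>t. norm (q t) * (1 + \<bar>t\<bar>) ^ k \<le> C * exp (- \<bar>t\<bar>))"

text \<open>The constant real part makes |x powr w t| independent of t, equal to x powr
  \<rho>.\<close>

definition linear_growth_on_line :: "real \<Rightarrow> (real \<Rightarrow> complex) \<Rightarrow> bool" where
  "linear_growth_on_line \<rho> w \<longleftrightarrow> continuous_on UNIV w \<and> (\<forall>t. Re (w t) = \<rho>) \<and>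
     (\<exists>K\<ge>0. \<forall>t. norm (w t) \<le> K * (1 + \<bar>t\<bar>))"

lemma linear_growth_on_line_diff_of_nat:
  assumes "linear_growth_on_line \<rho> w"
  shows "linear_growth_on_line (\<rho> - real j) (\<lambda>t. w t - of_nat j)"
proof -
  obtain K where K: "K \<ge> 0" "\<And>t. norm (w t) \<le> K * (1 + \<bar>t\<bar>)"
    using assms unfolding linear_growth_on_line_def by blast
  have "norm (w t - of_nat j) \<le> (K + real j) * (1 + \<bar>t\<bar>)" for t
  proof -
    have "norm (w t - of_nat j) \<le> norm (w t) + real j"
      using norm_triangle_ineq4[of "w t" "of_nat j"] by simp
    also have "\<dots> \<le> K * (1 + \<bar>t\<bar>) + real j * (1 + \<bar>t\<bar>)"
      using K(2)[of t] by (intro add_mono) (auto simp: algebra_simps)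
    finally show ?thesis by (simp add: algebra_simps)
  qed
  moreover have "K + real j \<ge> 0" using K(1) by simp
  ultimately have "\<exists>K\<ge>0. \<forall>t. norm (w t - of_nat j) \<le> K * (1 + \<bar>t\<bar>)" by blast
  moreover have "continuous_on UNIV w" "\<forall>t. Re (w t) = \<rho>"
    using assms unfolding linear_growth_on_line_def by auto
  ultimately show ?thesis
    unfolding linear_growth_on_line_def by (auto intro!: continuous_intros)
qed

lemma exp_decaying_mult:
  assumes q: "exp_decaying q" and w: "linear_growth_on_line \<rho> w"
  shows "exp_decaying (\<lambda>t. q t * w t)"
proof -
  obtain K where K: "K \<ge> 0" "\<And>t. norm (w t) \<le> K * (1 + \<bar>t\<bar>)"
    using w unfolding linear_growth_on_line_def by blast
  have "\<exists>C. \<forall>t. norm (q t * w t) * (1 + \<bar>t\<bar>) ^ k \<le> C * exp (- \<bar>t\<bar>)" for k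
  proof -
    obtain C where C: "\<And>t. norm (q t) * (1 + \<bar>t\<bar>) ^ Suc k \<le> C * exp (- \<bar>t\<bar>)"
      using q unfolding exp_decaying_def by blast
    have "norm (q t * w t) * (1 + \<bar>t\<bar>) ^ k \<le> (K * C) * exp (- \<bar>t\<bar>)" for t
    proof -
      have "norm (q t * w t) * (1 + \<bar>t\<bar>) ^ k \<le> norm (q t) * (K * (1 + \<bar>t\<bar>)) * (1 + \<bar>t\<bar>) ^ k"
        unfolding norm_mult using K(2)[of t] by (intro mult_right_mono mult_left_mono) auto
      also have "\<dots> = K * (norm (q t) * (1 + \<bar>t\<bar>) ^ Suc k)" by simp
      also have "\<dots> \<le> K * (C * exp (- \<bar>t\<bar>))" using C K(1) by (intro mult_left_mono) auto
      finally show ?thesis by (simp add: mult.assoc)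
    qed
    then show ?thesis by blast
  qed
  then show ?thesis using q w unfolding exp_decaying_def linear_growth_on_line_def
    by (auto intro!: continuous_intros)
qed

lemma norm_of_real_powr: "x > 0 \<Longrightarrow> norm (complex_of_real x powr w) = x powr Re w"
  by (simp add: norm_powr_real_powr)

lemma continuous_on_of_real_powr:
  assumes "continuous_on S w" "x > 0"
  shows "continuous_on S (\<lambda>t. complex_of_real x powr w t)"
  using assms by (auto simp: powr_def intro!: continuous_intros)

text \<open>The rate k stays explicit because it will be 1/c in the final estimate: the value 2/k is
  then the factor c lost in integrating.\<close>

lemma continuous_integrable_exp_bound:
  fixes f :: "real \<Rightarrow> complex"
  assumes "continuous_on UNIV f" "\<And>t. norm (f t) \<le> C * exp (- k * \<bar>t\<bar>)" "k > 0"
  shows "f integrable_on UNIV" "norm (integral UNIV f) \<le> C * (2 / k)"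
proof -
  have g: "((\<lambda>t. C * exp (- k * \<bar>t\<bar>)) has_integral C * (2 / k)) UNIV"
    by (intro has_integral_mult_right has_integral_exp_minus_abs assms)
  show f: "f integrable_on UNIV"
  proof (rule integrable_on_all_intervals_integrable_bound[OF _ assms(2)])
    show "(\<lambda>x. if x \<in> UNIV then f x else 0) integrable_on cbox a b" for a b
      using integrable_continuous[OF continuous_on_subset[OF assms(1) subset_UNIV]] by simp
  qed (use g in \<open>auto simp: integrable_on_def\<close>)
  show "norm (integral UNIV f) \<le> C * (2 / k)"
    using integral_norm_bound_integral[OF f has_integral_integrable[OF g] assms(2)] integral_unique[OF g]
    by simp
qed

lemma exp_decaying_integrable:
  assumes q: "exp_decaying q" and w: "linear_growth_on_line \<rho> w" and x: "x > 0"
  shows "(\<lambda>t. q t * complex_of_real x powr w t) integrable_on UNIV"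
proof -
  obtain C where C: "\<And>t. norm (q t) * (1 + \<bar>t\<bar>) ^ 0 \<le> C * exp (- \<bar>t\<bar>)"
    using q unfolding exp_decaying_def by blast
  show ?thesis
  proof (rule continuous_integrable_exp_bound(1)[where k = 1 and C = "C * x powr \<rho>"])
    show "continuous_on UNIV (\<lambda>t. q t * complex_of_real x powr w t)"
      using q w x unfolding exp_decaying_def linear_growth_on_line_def
      by (intro continuous_intros continuous_on_of_real_powr) auto
    show "norm (q t * complex_of_real x powr w t) \<le> C * x powr \<rho> * exp (- 1 * \<bar>t\<bar>)" for t
      using mult_right_mono[OF C[of t], of "x powr \<rho>"] w x
      by (simp add: norm_mult norm_of_real_powr linear_growth_on_line_def mult_ac)
  qed simp
qed

text \<open>Complex Taylor expansion along the real segment from x/2 to 2x, which is convex and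
  avoids the branch cut. The second derivative has norm |w| |w - 1| u powr (Re w - 2). This is
  monotone in u in a direction depending on the sign of Re w - 2, so the sum of the two endpoint
  values bounds it in both cases.\<close>

lemma of_real_powr_Taylor_remainder:
  fixes w :: complex
  assumes x: "x > 0" and y: "\<bar>y - x\<bar> \<le> x / 2"
  shows "norm (of_real y powr w - of_real x powr w - w * of_real x powr (w - 1) * of_real (y - x)) \<le>
    ((x / 2) powr (Re w - 2) + (2 * x) powr (Re w - 2)) * norm w * norm (w - 1) * (y - x)\<^sup>2"
proof -
  define S where "S = complex_of_real ` {x / 2..2 * x}"
  define f where "f = (\<lambda>i z. case i of 0 \<Rightarrow> z powr w | Suc 0 \<Rightarrow> w * z powr (w - 1) | _ \<Rightarrow> w * ((w - 1) * z powr (w - 2)))"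
  define B where "B = ((x / 2) powr (Re w - 2) + (2 * x) powr (Re w - 2)) * norm w * norm (w - 1)"
  have yx: "y \<in> {x / 2..2 * x}" "x \<in> {x / 2..2 * x}"
    using x y[unfolded abs_le_iff] unfolding atLeastAtMost_iff by linarith+
  have "norm (f 0 (of_real y) - (\<Sum>i\<le>1. f i (of_real x) * (of_real y - of_real x) ^ i / fact i)) \<le>
      B * norm (complex_of_real y - of_real x) ^ Suc 1 / fact 1"
  proof (rule field_Taylor[where S = S])
    show "convex S" unfolding S_def
      by (intro convex_linear_image) (auto simp: bounded_linear.linear bounded_linear_of_real)
    show "(f i has_field_derivative f (Suc i) z) (at z within S)" if z: "z \<in> S" and i: "i \<le> 1" for i z
    proof -
      have nz: "z \<notin> \<real>\<^sub>\<le>\<^sub>0" using z x by (auto simp: S_def complex_nonpos_Reals_iff)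
      have "i = 0 \<or> i = 1" using i by auto
      then show ?thesis
      proof
        assume "i = 0"
        then show ?thesis using has_field_derivative_powr[OF nz, of w]
          by (auto simp: f_def intro: has_field_derivative_at_within)
      next
        assume "i = 1"
        moreover have "((\<lambda>z. w * z powr (w - 1)) has_field_derivative w * ((w - 1) * z powr (w - 1 - 1))) (at z)"
          by (intro DERIV_cmult has_field_derivative_powr nz)
        ultimately show ?thesis by (auto simp: f_def intro: has_field_derivative_at_within)
      qed
    qed
    show "norm (f (Suc 1) z) \<le> B" if z: "z \<in> S" for z
    proof -
      obtain u where u: "z = of_real u" "x / 2 \<le> u" "u \<le> 2 * x" using z by (auto simp: S_def)
      have "u powr (Re w - 2) \<le> (x / 2) powr (Re w - 2) + (2 * x) powr (Re w - 2)"
      proof (cases "Re w - 2 \<ge> 0")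
        case True
        then have "u powr (Re w - 2) \<le> (2 * x) powr (Re w - 2)" using u x by (intro powr_mono2) auto
        then show ?thesis by (simp add: add_increasing)
      next
        case False
        then have "u powr (Re w - 2) \<le> (x / 2) powr (Re w - 2)" using u x by (intro powr_mono2') auto
        then show ?thesis by (simp add: add_increasing2)
      qed
      then have "norm w * norm (w - 1) * u powr (Re w - 2) \<le>
          norm w * norm (w - 1) * ((x / 2) powr (Re w - 2) + (2 * x) powr (Re w - 2))"
        by (intro mult_left_mono) auto
      then show ?thesis using u x
        by (simp add: f_def norm_mult norm_of_real_powr B_def mult_ac)
    qed
  qed (use yx in \<open>auto simp: S_def\<close>)
  then show ?thesis
    by (simp add: f_def B_def power2_eq_square diff_diff_eq2 flip: of_real_diff abs_mult)
      (simp add: algebra_simps)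
qed

definition power_integral :: "(real \<Rightarrow> complex) \<Rightarrow> (real \<Rightarrow> complex) \<Rightarrow> real \<Rightarrow> complex" where
  "power_integral q w x = integral UNIV (\<lambda>t. q t * of_real x powr w t)"

text \<open>The Taylor remainder of the integrand is (y - x)^2 times a function of t that is
  integrable uniformly in y, so integrating it gives the derivative directly from an explicit
  quadratic error.\<close>

lemma has_vector_derivative_power_integral:
  assumes q: "exp_decaying q" and w: "linear_growth_on_line \<rho> w" and x: "x > 0"
  shows "(power_integral q w has_vector_derivative power_integral (\<lambda>t. q t * w t) (\<lambda>t. w t - 1) x) (at x)"
proof -
  note w1 = linear_growth_on_line_diff_of_nat[OF w, of 1, simplified]
  obtain K where K: "K \<ge> 0" "\<And>t. norm (w t) \<le> K * (1 + \<bar>t\<bar>)"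
    using w unfolding linear_growth_on_line_def by blast
  obtain C where C: "\<And>t. norm (q t * w t * (w t - 1)) * (1 + \<bar>t\<bar>) ^ 0 \<le> C * exp (- \<bar>t\<bar>)"
    using exp_decaying_mult[OF exp_decaying_mult[OF q w] w1] unfolding exp_decaying_def by blast
  have C0: "C \<ge> 0" using order_trans[OF norm_ge_zero C[of 0, simplified]] by simp
  define M where "M = (x / 2) powr (\<rho> - 2) + (2 * x) powr (\<rho> - 2)"
  have M: "M > 0" using x unfolding M_def by (intro add_pos_pos) auto
  let ?D = "power_integral (\<lambda>t. q t * w t) (\<lambda>t. w t - 1) x"
  have main: "norm (power_integral q w y - power_integral q w x - (y - x) *\<^sub>R ?D) \<le> 2 * C * M * (y - x)\<^sup>2"
    if y: "\<bar>y - x\<bar> \<le> x / 2" for y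
  proof -
    have ypos: "y > 0" using y[unfolded abs_le_iff] x by linarith
    let ?r = "\<lambda>t. q t * (of_real y powr w t - of_real x powr w t - w t * of_real x powr (w t - 1) * of_real (y - x))"
    have "((\<lambda>t. q t * of_real y powr w t - q t * of_real x powr w t - (y - x) *\<^sub>R (q t * w t * of_real x powr (w t - 1)))
        has_integral (power_integral q w y - power_integral q w x - (y - x) *\<^sub>R ?D)) UNIV"
      unfolding power_integral_def
      by (intro has_integral_diff has_integral_cmul integrable_integral exp_decaying_integrable[OF q w x]
            exp_decaying_integrable[OF q w ypos] exp_decaying_integrable[OF exp_decaying_mult[OF q w] w1 x])
    then have r: "(?r has_integral (power_integral q w y - power_integral q w x - (y - x) *\<^sub>R ?D)) UNIV"
      by (rule has_integral_eq[rotated]) (simp add: algebra_simps scaleR_conv_of_real)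
    have "norm (integral UNIV ?r) \<le> C * M * (y - x)\<^sup>2 * (2 / 1)"
    proof (rule continuous_integrable_exp_bound(2))
      show "continuous_on UNIV ?r"
        using q w w1 x ypos unfolding exp_decaying_def linear_growth_on_line_def
        by (intro continuous_intros continuous_on_of_real_powr) auto
      show "norm (?r t) \<le> C * M * (y - x)\<^sup>2 * exp (- 1 * \<bar>t\<bar>)" for t
      proof -
        have Rw: "Re (w t) = \<rho>" using w by (simp add: linear_growth_on_line_def)
        have "norm (?r t) \<le> norm (q t) * (M * norm (w t) * norm (w t - 1) * (y - x)\<^sup>2)"
          unfolding norm_mult[of "q t"] using of_real_powr_Taylor_remainder[OF x y, of "w t"]
          unfolding Rw M_def by (intro mult_left_mono) auto
        also have "\<dots> = M * (y - x)\<^sup>2 * norm (q t * w t * (w t - 1))" by (simp add: norm_mult)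
        also have "\<dots> \<le> M * (y - x)\<^sup>2 * (C * exp (- \<bar>t\<bar>))"
          using C[of t] M by (intro mult_left_mono) auto
        finally show ?thesis by (simp add: mult_ac)
      qed
    qed simp
    then show ?thesis using integral_unique[OF r] by (simp add: mult_ac)
  qed
  show ?thesis
    unfolding has_vector_derivative_def has_derivative_at_alt
  proof (intro conjI allI impI)
    show "bounded_linear (\<lambda>h. h *\<^sub>R ?D)" by (rule bounded_linear_scaleR_left)
    fix e :: real assume e: "e > 0"
    \<comment> \<open>The summand 1 makes \<open>A\<close> positive even if \<open>C\<close> is 0,
      so that e / A is a valid radius.\<close>
    define A where "A = 2 * C * M + 1"
    have A: "A > 0" using C0 M by (simp add: A_def add_nonneg_pos)
    define d where "d = min (x / 2) (e / A)"
    have "norm (power_integral q w y - power_integral q w x - (y - x) *\<^sub>R ?D) \<le> e * norm (y - x)"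
      if y: "norm (y - x) < d" for y
    proof -
      have "norm (power_integral q w y - power_integral q w x - (y - x) *\<^sub>R ?D) \<le> 2 * C * M * (y - x)\<^sup>2"
        using main[of y] y by (simp add: d_def)
      also have "\<dots> \<le> A * (y - x)\<^sup>2" by (intro mult_right_mono) (auto simp: A_def)
      also have "\<dots> = (A * norm (y - x)) * norm (y - x)" by (simp add: power2_eq_square abs_mult_self_eq)
      also have "A * norm (y - x) \<le> e" using y A by (simp add: d_def field_simps)
      finally show ?thesis by (simp add: mult_right_mono)
    qed
    moreover have "d > 0" using x e A by (simp add: d_def)
    ultimately show "\<exists>d>0. \<forall>y. norm (y - x) < d \<longrightarrow>
        norm (power_integral q w y - power_integral q w x - (y - x) *\<^sub>R ?D) \<le> e * norm (y - x)" by blast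
  qed
qed

text \<open>Each differentiation multiplies the density by the current exponent and lowers the
  exponent by 1, whence the falling product. The formula for \<open>f\<close> is known only for x >
  0, so derivatives are transferred on the open half-line.\<close>

lemma nth_deriv_power_integral:
  assumes g: "exp_decaying g" and w: "linear_growth_on_line \<rho> w"
    and f: "\<And>x. x > 0 \<Longrightarrow> f x = c * power_integral g w x"
  shows "x > 0 \<Longrightarrow> nth_deriv j f x = c * power_integral (\<lambda>t. g t * (\<Prod>i<j. w t - of_nat i)) (\<lambda>t. w t - of_nat j) x"
    and "x > 0 \<Longrightarrow> nth_deriv j f differentiable (at x)"
proof -
  define q where "q = (\<lambda>j t. g t * (\<Prod>i<j. w t - of_nat i))"
  have q: "exp_decaying (q j)" for j
  proof (induction j)
    case 0
    then show ?case using g by (simp add: q_def)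
  next
    case (Suc j)
    from exp_decaying_mult[OF this linear_growth_on_line_diff_of_nat[OF w, of j]]
    show ?case by (simp add: q_def mult.assoc)
  qed
  have D: "(nth_deriv j f has_vector_derivative c * power_integral (q (Suc j)) (\<lambda>t. w t - of_nat (Suc j)) x) (at x)"
    if eq: "\<And>x. x > 0 \<Longrightarrow> nth_deriv j f x = c * power_integral (q j) (\<lambda>t. w t - of_nat j) x" and x: "x > 0" for j x
  proof (rule has_vector_derivative_transform_within_open)
    have "(power_integral (q j) (\<lambda>t. w t - of_nat j) has_vector_derivative
       power_integral (\<lambda>t. q j t * (w t - of_nat j)) (\<lambda>t. w t - of_nat j - 1) x) (at x)"
      by (rule has_vector_derivative_power_integral[OF q linear_growth_on_line_diff_of_nat[OF w] x])
    also have "(\<lambda>t. q j t * (w t - of_nat j)) = q (Suc j)" by (simp add: q_def mult.assoc)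
    also have "(\<lambda>t. w t - of_nat j - 1) = (\<lambda>t. w t - of_nat (Suc j))" by (simp add: algebra_simps)
    finally show "((\<lambda>x. c * power_integral (q j) (\<lambda>t. w t - of_nat j) x) has_vector_derivative
        c * power_integral (q (Suc j)) (\<lambda>t. w t - of_nat (Suc j)) x) (at x)"
      by (rule has_vector_derivative_mult_right)
    show "open {0::real<..}" by simp
  qed (use eq x in auto)
  have eq: "nth_deriv j f x = c * power_integral (q j) (\<lambda>t. w t - of_nat j) x" if "x > 0" for j x
    using that
  proof (induction j arbitrary: x)
    case 0
    then show ?case using f by (simp add: nth_deriv_def q_def)
  next
    case (Suc j)
    have "nth_deriv (Suc j) f x = vector_derivative (nth_deriv j f) (at x)" by (simp add: nth_deriv_def)
    also have "\<dots> = c * power_integral (q (Suc j)) (\<lambda>t. w t - of_nat (Suc j)) x"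
      by (rule vector_derivative_at, rule D[OF Suc.IH Suc.prems])
    finally show ?case .
  qed
  show "x > 0 \<Longrightarrow> nth_deriv j f x = c * power_integral (\<lambda>t. g t * (\<Prod>i<j. w t - of_nat i)) (\<lambda>t. w t - of_nat j) x"
    using eq[of x j] by (simp add: q_def)
  show "x > 0 \<Longrightarrow> nth_deriv j f differentiable (at x)"
    using D[OF eq] by (rule differentiableI_vector)
qed

section \<open>Bessel integrals\<close>

definition gamma_poles :: "nat \<Rightarrow> (nat \<Rightarrow> complex) \<Rightarrow> complex set" where
  "gamma_poles n lam = (\<Union>l\<in>{1..n}. {z. z - lam l \<in> \<int>\<^sub>\<le>\<^sub>0})"

lemma in_gamma_poles_iff: "z \<in> gamma_poles n lam \<longleftrightarrow> (\<exists>l\<in>{1..n}. \<exists>k::nat. z = lam l - of_nat k)"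
proof -
  have "z - lam l \<in> \<int>\<^sub>\<le>\<^sub>0 \<longleftrightarrow> (\<exists>k::nat. z = lam l - of_nat k)" for l
  proof
    assume "z - lam l \<in> \<int>\<^sub>\<le>\<^sub>0"
    then obtain k where "z - lam l = - of_nat k" by (elim nonpos_Ints_cases')
    then have "z = lam l - of_nat k" by (simp add: algebra_simps)
    then show "\<exists>k::nat. z = lam l - of_nat k" ..
  qed auto
  then show ?thesis unfolding gamma_poles_def by blast
qed

lemma closed_gamma_poles: "closed (gamma_poles n lam)"
  unfolding gamma_poles_def
proof (intro closed_UN ballI)
  fix l
  have "closed ((\<lambda>z. z - lam l) -` \<int>\<^sub>\<le>\<^sub>0)"
    by (intro closed_vimage closed_nonpos_Ints continuous_intros)
  then show "closed {z. z - lam l \<in> \<int>\<^sub>\<le>\<^sub>0}" by (simp add: vimage_def)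
qed simp

lemma finite_gamma_poles_right: "finite {z \<in> gamma_poles n lam. b \<le> Re z}"
proof (rule finite_subset)
  show "{z \<in> gamma_poles n lam. b \<le> Re z} \<subseteq> (\<Union>l\<in>{1..n}. (\<lambda>k. lam l - of_nat k) ` {..nat \<lceil>Re (lam l) - b\<rceil>})"
  proof
    fix z assume "z \<in> {z \<in> gamma_poles n lam. b \<le> Re z}"
    then obtain l k where lk: "l \<in> {1..n}" "z = lam l - of_nat k" "b \<le> Re z"
      unfolding in_gamma_poles_iff mem_Collect_eq by blast
    then have "k \<le> nat \<lceil>Re (lam l) - b\<rceil>" by (simp add: le_nat_iff) linarith
    with lk show "z \<in> (\<Union>l\<in>{1..n}. (\<lambda>k. lam l - of_nat k) ` {..nat \<lceil>Re (lam l) - b\<rceil>})" by blast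
  qed
qed auto

lemma holomorphic_bessel_gamma_factor:
  "bessel_gamma_factor n \<sigma>s lam holomorphic_on - gamma_poles n lam"
proof -
  have "(\<lambda>s. \<Prod>l = 1..n. Gamma (s - lam l) * e_fun (of_int (\<sigma>s l) * (s - lam l) / 4)) holomorphic_on - gamma_poles n lam"
    unfolding e_fun_def
    by (intro holomorphic_on_prod holomorphic_on_mult holomorphic_Gamma' holomorphic_intros)
       (auto simp: gamma_poles_def)
  then show ?thesis unfolding bessel_gamma_factor_def .
qed

text \<open>The exponential decay in every vertical strip permits the shift to Re s = \<sigma>.
  There ds = i dt, and this i cancels the one in 1 / (2 \<pi> i).\<close>

lemma bessel_J_eq_power_integral:
  assumes \<sigma>s: "\<And>l. l \<in> {1..n} \<Longrightarrow> \<sigma>s l \<in> {1, -1}"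
    and pq: "p \<in> {1..n}" "\<sigma>s p = 1" "q \<in> {1..n}" "\<sigma>s q = -1"
    and \<gamma>: "bessel_contour n lam \<gamma>" and \<sigma>: "\<And>l. l \<in> {1..n} \<Longrightarrow> Re (lam l) < \<sigma>" and x: "x > 0"
  shows "bessel_J n \<sigma>s lam \<gamma> x = 1 / (2 * of_real pi) *
     power_integral (\<lambda>t. bessel_gamma_factor n \<sigma>s lam (Complex \<sigma> t)) (\<lambda>t. - (of_nat n * Complex \<sigma> t)) x"
proof -
  let ?P = "gamma_poles n lam"
  let ?F = "\<lambda>s. bessel_gamma_factor n \<sigma>s lam s * of_real x powr (- (of_nat n * s))"
  obtain a where a: "upward_contour a \<gamma>" using \<gamma> unfolding bessel_contour_def by blast
  have P: "?P \<subseteq> left_side \<gamma>" using \<gamma> unfolding bessel_contour_def by (auto simp: in_gamma_poles_iff)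
  have F: "?F holomorphic_on - ?P"
    using x by (intro holomorphic_on_mult holomorphic_bessel_gamma_factor holomorphic_intros) auto
  have decay: "\<exists>C T. \<forall>s. \<alpha> \<le> Re s \<longrightarrow> Re s \<le> \<beta> \<longrightarrow> T \<le> \<bar>Im s\<bar> \<longrightarrow> norm (?F s) \<le> C * exp (- \<bar>Im s\<bar>)" for \<alpha> \<beta>
  proof -
    obtain C T where C: "C > 0" "\<And>s. \<lbrakk>\<alpha> \<le> Re s; Re s \<le> \<beta>; T \<le> \<bar>Im s\<bar>\<rbrakk> \<Longrightarrow>
       norm (bessel_gamma_factor n \<sigma>s lam s) \<le> C * exp (- 2 * \<bar>Im s\<bar>)"
      using bessel_gamma_factor_strip_decay[where \<alpha> = \<alpha> and \<beta> = \<beta> and lam = lam, OF \<sigma>s pq] by blast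
    \<comment> \<open>The power of x is monotone in Re s, in a direction depending on whether x
      \<ge> 1; the sum of the values on the two edges of the strip covers both cases.\<close>
    define D where "D = x powr (- (real n * \<alpha>)) + x powr (- (real n * \<beta>))"
    have "norm (?F s) \<le> (C * D) * exp (- \<bar>Im s\<bar>)" if s: "\<alpha> \<le> Re s" "Re s \<le> \<beta>" "T \<le> \<bar>Im s\<bar>" for s
    proof -
      have "x powr (- (real n * Re s)) \<le> D"
      proof (cases "x \<ge> 1")
        case True
        then have "x powr (- (real n * Re s)) \<le> x powr (- (real n * \<alpha>))"
          using s by (intro powr_mono) (auto intro: mult_left_mono)
        then show ?thesis by (simp add: D_def add_increasing2)
      next
        case False
        then have "x powr (- (real n * Re s)) \<le> x powr (- (real n * \<beta>))"
          using s x by (intro powr_mono') (auto intro: mult_left_mono)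
        then show ?thesis by (simp add: D_def add_increasing)
      qed
      moreover have "C * exp (- 2 * \<bar>Im s\<bar>) \<le> C * exp (- \<bar>Im s\<bar>)" using C(1) by simp
      then have "norm (bessel_gamma_factor n \<sigma>s lam s) \<le> C * exp (- \<bar>Im s\<bar>)" using C(2)[OF s] by linarith
      ultimately have "norm (?F s) \<le> C * exp (- \<bar>Im s\<bar>) * D"
        unfolding norm_mult using C(1) x by (intro mult_mono) (auto simp: norm_of_real_powr)
      then show ?thesis by (simp add: mult_ac)
    qed
    then show ?thesis by blast
  qed
  have "integral UNIV (\<lambda>t. ?F (\<gamma> t) * vector_derivative \<gamma> (at t)) = \<i> * integral UNIV (\<lambda>t. ?F (Complex \<sigma> t))"
  proof (rule upward_contour_shift[OF a P closed_gamma_poles finite_gamma_poles_right F decay])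
    fix z assume "z \<in> ?P"
    then obtain l k where "l \<in> {1..n}" "z = lam l - of_nat k" unfolding in_gamma_poles_iff by blast
    with \<sigma>[of l] show "Re z < \<sigma>" by simp
  qed
  then show ?thesis unfolding bessel_J_def power_integral_def by simp
qed

text \<open>Strip decay, used for the degenerate strip Re s = \<sigma>, handles large |t|; on the
  compact rest continuity suffices, since the line meets no pole.\<close>

lemma exp_decaying_bessel_gamma_factor:
  assumes \<sigma>s: "\<And>l. l \<in> {1..n} \<Longrightarrow> \<sigma>s l \<in> {1, -1}"
    and pq: "p \<in> {1..n}" "\<sigma>s p = 1" "q \<in> {1..n}" "\<sigma>s q = -1"
    and \<sigma>: "\<And>l. l \<in> {1..n} \<Longrightarrow> Re (lam l) < \<sigma>"
  shows "exp_decaying (\<lambda>t. bessel_gamma_factor n \<sigma>s lam (Complex \<sigma> t))"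
proof -
  let ?g = "\<lambda>t. bessel_gamma_factor n \<sigma>s lam (Complex \<sigma> t)"
  have line: "Complex \<sigma> t \<in> - gamma_poles n lam" for t
  proof
    assume "Complex \<sigma> t \<in> gamma_poles n lam"
    then obtain l k where l: "l \<in> {1..n}" "Complex \<sigma> t = lam l - of_nat k" unfolding in_gamma_poles_iff by blast
    from arg_cong[OF l(2), of Re] \<sigma>[OF l(1)] show False by simp
  qed
  have "continuous_on UNIV (Complex \<sigma>)"
    by (intro continuous_at_imp_continuous_on ballI) (rule has_vector_derivative_continuous[OF has_vector_derivative_vertical_line])
  then have cont: "continuous_on UNIV ?g"
    using line by (intro continuous_on_compose2[OF holomorphic_on_imp_continuous_on[OF holomorphic_bessel_gamma_factor]]) auto
  obtain C T where C: "C > 0" "\<And>s. \<lbrakk>\<sigma> \<le> Re s; Re s \<le> \<sigma>; T \<le> \<bar>Im s\<bar>\<rbrakk> \<Longrightarrow>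
     norm (bessel_gamma_factor n \<sigma>s lam s) \<le> C * exp (- 2 * \<bar>Im s\<bar>)"
    using bessel_gamma_factor_strip_decay[where \<alpha> = \<sigma> and \<beta> = \<sigma> and lam = lam, OF \<sigma>s pq] by blast
  have "bounded (?g ` {-T..T})"
    by (intro compact_imp_bounded compact_continuous_image continuous_on_subset[OF cont]) auto
  then obtain B where B: "B > 0" "\<And>t. t \<in> {-T..T} \<Longrightarrow> norm (?g t) \<le> B"
    unfolding bounded_pos by blast
  \<comment> \<open>The factor \<open>exp (2 * T)\<close> compensates for exp (-2 |t|) on |t| <
    T.\<close>
  define E where "E = C + B * exp (2 * T)"
  have g: "norm (?g t) \<le> E * exp (- 2 * \<bar>t\<bar>)" for t
  proof (cases "T \<le> \<bar>t\<bar>")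
    case True
    then have "norm (?g t) \<le> C * exp (- 2 * \<bar>t\<bar>)" using C(2)[of "Complex \<sigma> t"] by simp
    also have "\<dots> \<le> E * exp (- 2 * \<bar>t\<bar>)" using B(1) by (intro mult_right_mono) (auto simp: E_def)
    finally show ?thesis .
  next
    case False
    then have "norm (?g t) \<le> B" by (intro B(2)) auto
    also have "B * 1 \<le> B * (exp (2 * T) * exp (- 2 * \<bar>t\<bar>))"
      using False B(1) by (intro mult_left_mono) (auto simp flip: exp_add)
    then have "B \<le> (B * exp (2 * T)) * exp (- 2 * \<bar>t\<bar>)" by simp
    also have "\<dots> \<le> E * exp (- 2 * \<bar>t\<bar>)" using C(1) by (intro mult_right_mono) (auto simp: E_def)
    finally show ?thesis .
  qed
  have E: "E > 0" using B C by (simp add: E_def add_pos_pos)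
  have "norm (?g t) * (1 + \<bar>t\<bar>) ^ k \<le> (E * fact k * exp 1) * exp (- \<bar>t\<bar>)" for k t
  proof -
    have "norm (?g t) * (1 + \<bar>t\<bar>) ^ k \<le> (E * exp (- 2 * \<bar>t\<bar>)) * (fact k * exp (1 + \<bar>t\<bar>))"
      using E by (intro mult_mono g power_le_fact_mult_exp) auto
    also have "\<dots> = E * fact k * (exp (- 2 * \<bar>t\<bar>) * exp (1 + \<bar>t\<bar>))" by (simp only: mult_ac)
    also have "exp (- 2 * \<bar>t\<bar>) * exp (1 + \<bar>t\<bar>) = exp 1 * exp (- \<bar>t\<bar>)" by (simp flip: exp_add)
    finally show ?thesis by (simp only: mult_ac)
  qed
  with cont show ?thesis unfolding exp_decaying_def by blast
qed

lemma linear_growth_bessel_exponent: "linear_growth_on_line (- (real n * \<sigma>)) (\<lambda>t. - (of_nat n * Complex \<sigma> t))"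
  unfolding linear_growth_on_line_def
proof (intro conjI allI)
  have "continuous_on UNIV (Complex \<sigma>)"
    by (intro continuous_at_imp_continuous_on ballI) (rule has_vector_derivative_continuous[OF has_vector_derivative_vertical_line])
  then show "continuous_on UNIV (\<lambda>t. - (of_nat n * Complex \<sigma> t))" by (intro continuous_intros)
  have "norm (- (of_nat n * Complex \<sigma> t)) \<le> (real n * (\<bar>\<sigma>\<bar> + 1)) * (1 + \<bar>t\<bar>)" for t
  proof -
    have "norm (Complex \<sigma> t) \<le> \<bar>\<sigma>\<bar> + \<bar>t\<bar>" using cmod_le[of "Complex \<sigma> t"] by simp
    also have "\<dots> \<le> (\<bar>\<sigma>\<bar> + 1) * (1 + \<bar>t\<bar>)" by (simp add: algebra_simps)
    finally show ?thesis by (simp add: norm_mult mult.assoc mult_left_mono)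
  qed
  then show "\<exists>K\<ge>0. \<forall>t. norm (- (of_nat n * Complex \<sigma> t)) \<le> K * (1 + \<bar>t\<bar>)"
    by (intro exI[of _ "real n * (\<bar>\<sigma>\<bar> + 1)"]) auto
qed simp

section \<open>Estimates on the shifted line, uniform in c\<close>

text \<open>Replaces a plateau of half-width 2c with a steep tail by a single exponential of rate
  1/c, whose integral is again of order c. On the plateau |t| / c \<le> 2, which is the origin of
  \<open>exp 2\<close>; beyond it c \<ge> 1 makes the tail steeper than rate 1/c.\<close>

lemma exp_minus_excess_le:
  fixes c t :: real
  assumes c: "c \<ge> 1"
  shows "exp (- max 0 (\<bar>t\<bar> - 2 * c)) \<le> exp 2 * exp (- (1 / c) * \<bar>t\<bar>)"
proof -
  define u where "u = max 0 (\<bar>t\<bar> - 2 * c)"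
  have "\<bar>t\<bar> - 2 * c \<le> u" "u \<ge> 0" unfolding u_def by auto
  moreover have "u \<le> c * u" using mult_right_mono[OF c \<open>u \<ge> 0\<close>] by simp
  ultimately have "\<bar>t\<bar> \<le> c * (2 + u)" by (simp add: algebra_simps)
  then have "\<bar>t\<bar> / c \<le> 2 + u" using c by (simp add: field_simps)
  then have "exp (- u) \<le> exp (2 + - (1 / c) * \<bar>t\<bar>)" by simp
  then show ?thesis unfolding u_def exp_add .
qed

text \<open>With u the excess of |t| over 2c, the base 1 + |t| + 2c is at most 5c (1 + u). The
  powers of c come out with their exact exponent, and those of 1 + u are absorbed by the
  exponential.\<close>

lemma powr_mult_exp_excess_le:
  fixes P :: real
  assumes c: "c \<ge> 1" and P: "P \<ge> 0"
  shows "(1 + \<bar>t\<bar> + 2 * c) powr P * (1 + \<bar>t\<bar>) ^ j * exp (- pi * max 0 (\<bar>t\<bar> - 2 * c)) \<le>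
    5 powr (P + real j) * fact (nat \<lceil>P\<rceil> + j) * exp 3 * c powr (P + real j) * exp (- (1 / c) * \<bar>t\<bar>)"
proof -
  define u where "u = max 0 (\<bar>t\<bar> - 2 * c)"
  have u: "\<bar>t\<bar> \<le> 2 * c + u" "u \<ge> 0" unfolding u_def by auto
  define N where "N = nat \<lceil>P\<rceil> + j"
  have cu: "c * u \<ge> u" using mult_right_mono[OF c u(2)] by simp
  \<comment> \<open>From 1 + 2c + 2c \<le> 5c and u \<le> cu, both by c \<ge> 1.\<close>
  have X: "1 + \<bar>t\<bar> + 2 * c \<le> (5 * c) * (1 + u)" using u c cu by (simp add: algebra_simps)
  have pos: "0 < 1 + \<bar>t\<bar> + 2 * c" using c by linarith
  have "(1 + \<bar>t\<bar> + 2 * c) powr P * (1 + \<bar>t\<bar>) ^ j \<le> (1 + \<bar>t\<bar> + 2 * c) powr P * (1 + \<bar>t\<bar> + 2 * c) ^ j"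
    using c by (intro mult_left_mono power_mono) auto
  also have "\<dots> = (1 + \<bar>t\<bar> + 2 * c) powr (P + real j)"
    using pos by (simp add: powr_add powr_realpow)
  also have "\<dots> \<le> ((5 * c) * (1 + u)) powr (P + real j)"
    using P X pos by (intro powr_mono2) auto
  also have "\<dots> = (5 * c) powr (P + real j) * (1 + u) powr (P + real j)"
    by (rule powr_mult)
  also have "\<dots> \<le> (5 * c) powr (P + real j) * (1 + u) powr real N"
  proof (rule mult_left_mono)
    show "(1 + u) powr (P + real j) \<le> (1 + u) powr real N"
      using u(2) unfolding N_def by (intro powr_mono) linarith+
  qed simp
  also have "(1 + u) powr real N = (1 + u) ^ N" using u(2) by (intro powr_realpow) linarith
  also have "(5 * c) powr (P + real j) = 5 powr (P + real j) * c powr (P + real j)" by (rule powr_mult)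
  finally have 1: "(1 + \<bar>t\<bar> + 2 * c) powr P * (1 + \<bar>t\<bar>) ^ j \<le> 5 powr (P + real j) * c powr (P + real j) * (1 + u) ^ N" .
  \<comment> \<open>Rate \<pi> is lowered to 2: one exp (-u) pays for the power of 1 + u at the
    price \<open>exp 1\<close>, the other becomes the exponential of rate 1/c at the price
    \<open>exp 2\<close>. Together these give \<open>exp 3\<close>.\<close>
  have "(1 + u) ^ N * exp (- pi * u) \<le> (fact N * exp (1 + u)) * exp (- 2 * u)"
  proof (intro mult_mono power_le_fact_mult_exp)
    show "exp (- pi * u) \<le> exp (- 2 * u)" using pi_gt3 u(2) by (simp add: mult_right_mono)
  qed (use u(2) in auto)
  also have "\<dots> = fact N * exp 1 * exp (- u)" by (simp add: mult.assoc flip: exp_add)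
  also have "\<dots> \<le> fact N * exp 1 * (exp 2 * exp (- (1 / c) * \<bar>t\<bar>))"
    using exp_minus_excess_le[OF c, of t] unfolding u_def by (intro mult_left_mono) auto
  also have "\<dots> = fact N * exp 3 * exp (- (1 / c) * \<bar>t\<bar>)" 
    using exp_add[of "1::real" 2] by simp
  finally have 2: "(1 + u) ^ N * exp (- pi * u) \<le> fact N * exp 3 * exp (- (1 / c) * \<bar>t\<bar>)" .
  have "(1 + \<bar>t\<bar> + 2 * c) powr P * (1 + \<bar>t\<bar>) ^ j * exp (- pi * u) \<le>
      5 powr (P + real j) * c powr (P + real j) * (1 + u) ^ N * exp (- pi * u)"
    using 1 by (intro mult_right_mono) auto
  also have "\<dots> = 5 powr (P + real j) * c powr (P + real j) * ((1 + u) ^ N * exp (- pi * u))"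
    by (simp only: mult.assoc)
  also have "\<dots> \<le> 5 powr (P + real j) * c powr (P + real j) * (fact N * exp 3 * exp (- (1 / c) * \<bar>t\<bar>))"
    using 2 by (intro mult_left_mono) auto
  finally show ?thesis unfolding u_def[symmetric] N_def[symmetric] by (simp only: mult_ac)
qed

lemma norm_falling_product_le:
  "norm (\<Prod>i<j. - (of_nat n * Complex \<sigma> t) - of_nat i) \<le> (real n * (\<bar>\<sigma>\<bar> + 1) + real j) ^ j * (1 + \<bar>t\<bar>) ^ j"
proof -
  have "norm (- (of_nat n * Complex \<sigma> t) - of_nat i) \<le> (real n * (\<bar>\<sigma>\<bar> + 1) + real j) * (1 + \<bar>t\<bar>)" if "i < j" for i
  proof -
    have "norm (- (of_nat n * Complex \<sigma> t) - of_nat i) \<le> real n * norm (Complex \<sigma> t) + real i"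
      using norm_triangle_ineq4[of "- (of_nat n * Complex \<sigma> t)" "of_nat i"] by (simp add: norm_mult)
    also have "\<dots> \<le> real n * ((\<bar>\<sigma>\<bar> + 1) * (1 + \<bar>t\<bar>)) + real j * (1 + \<bar>t\<bar>)"
    proof (intro add_mono mult_left_mono)
      have "norm (Complex \<sigma> t) \<le> \<bar>\<sigma>\<bar> + \<bar>t\<bar>" using cmod_le[of "Complex \<sigma> t"] by simp
      also have "\<dots> \<le> (\<bar>\<sigma>\<bar> + 1) * (1 + \<bar>t\<bar>)" by (simp add: algebra_simps)
      finally show "norm (Complex \<sigma> t) \<le> (\<bar>\<sigma>\<bar> + 1) * (1 + \<bar>t\<bar>)" .
      have "real i \<le> real j * 1" using that by simp
      also have "\<dots> \<le> real j * (1 + \<bar>t\<bar>)" by (intro mult_left_mono) auto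
      finally show "real i \<le> real j * (1 + \<bar>t\<bar>)" .
    qed auto
    finally show ?thesis by (simp add: algebra_simps)
  qed
  then have "(\<Prod>i<j. norm (- (of_nat n * Complex \<sigma> t) - of_nat i)) \<le> (\<Prod>i<j. (real n * (\<bar>\<sigma>\<bar> + 1) + real j) * (1 + \<bar>t\<bar>))"
    by (intro prod_mono) auto
  then show ?thesis by (simp add: power_mult_distrib flip: prod_norm)
qed

text \<open>\<open>K\<close> is fixed before \<lambda>, the signs, the contour and c, and so depends
  on n, R, j and M only. The powers of c and x combine into one power of c / x because the imaginary
  parts of the \<lambda>'s are of size c.\<close>

lemma nth_deriv_bessel_J_bound:
  assumes n: "n \<ge> 2"
  obtains K where "\<And>lam \<sigma>s \<gamma> c p q x. \<lbrakk>c \<ge> 1; (\<Sum>l = 1..n. lam l) = 0;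
      \<And>l. l \<in> {1..n} \<Longrightarrow> \<bar>Re (lam l)\<bar> \<le> R \<and> \<bar>Im (lam l)\<bar> \<le> 2 * c \<and> \<sigma>s l \<in> {1, -1};
      p \<in> {1..n}; \<sigma>s p = 1; q \<in> {1..n}; \<sigma>s q = -1; bessel_contour n lam \<gamma>; x \<ge> c\<rbrakk> \<Longrightarrow>
      norm (nth_deriv j (bessel_J n \<sigma>s lam \<gamma>) x) \<le> K * (c / x) ^ M"
proof -
  \<comment> \<open>The part |R| + 3/2 puts every s - \<lambda> into the range of the sharp Gamma
    bound; the part M makes n\<sigma> at least M. The absolute value is there because R is an
    arbitrary real.\<close>
  define \<sigma> where "\<sigma> = \<bar>R\<bar> + 3/2 + real M"
  define P where "P = real n * \<sigma> - real n / 2"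
  have P0: "P \<ge> 0" unfolding P_def \<sigma>_def by (simp add: algebra_simps)
  obtain K where K: "K > 0" and G: "\<And>\<sigma>s lam s L p q. 
    \<lbrakk>\<And>l. l \<in> {1..n} \<Longrightarrow> 3/2 \<le> Re (s - lam l) \<and> Re (s - lam l) \<le> \<sigma> + \<bar>R\<bar> \<and> \<bar>Im (lam l)\<bar> \<le> L \<and> \<sigma>s l \<in> {1, -1};
     p \<in> {1..n}; \<sigma>s p = 1; q \<in> {1..n}; \<sigma>s q = -1\<rbrakk> \<Longrightarrow>
    norm (bessel_gamma_factor n \<sigma>s lam s) \<le>
      K ^ n * (1 + \<bar>Im s\<bar> + L) powr (real n * Re s - Re (\<Sum>l = 1..n. lam l) - real n / 2) *
      exp (- pi * max 0 (\<bar>Im s\<bar> - L))"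
    using bessel_gamma_factor_bound[of "\<sigma> + \<bar>R\<bar>"] by (metis (no_types, lifting))
  define W where "W = (real n * (\<bar>\<sigma>\<bar> + 1) + real j) ^ j"
  define H where "H = K ^ n * W * (5 powr (P + real j) * fact (nat \<lceil>P\<rceil> + j) * exp 3)"
  have W: "W \<ge> 0" by (simp add: W_def)
  have H: "H \<ge> 0" unfolding H_def using K W by simp
  have "norm (nth_deriv j (bessel_J n \<sigma>s lam \<gamma>) x) \<le> H * (c / x) ^ M"
    if c: "c \<ge> 1" and lam0: "(\<Sum>l = 1..n. lam l) = 0"
      and lam: "\<And>l. l \<in> {1..n} \<Longrightarrow> \<bar>Re (lam l)\<bar> \<le> R \<and> \<bar>Im (lam l)\<bar> \<le> 2 * c \<and> \<sigma>s l \<in> {1, -1}"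
      and pq: "p \<in> {1..n}" "\<sigma>s p = 1" "q \<in> {1..n}" "\<sigma>s q = -1"
      and \<gamma>: "bessel_contour n lam \<gamma>" and x: "x \<ge> c"
    for lam \<sigma>s \<gamma> c p q x
  proof -
    let ?w = "\<lambda>t. - (of_nat n * Complex \<sigma> t)"
    let ?g = "\<lambda>t. bessel_gamma_factor n \<sigma>s lam (Complex \<sigma> t)"
    let ?q = "\<lambda>t. ?g t * (\<Prod>i<j. ?w t - of_nat i)"
    have x0: "x > 0" using c x by simp
    have signs: "\<And>l. l \<in> {1..n} \<Longrightarrow> \<sigma>s l \<in> {1, -1}" using lam by blast
    have lam_less: "Re (lam l) < \<sigma>" if "l \<in> {1..n}" for l
      using lam[OF that] unfolding \<sigma>_def by linarith
    have dec: "exp_decaying ?g" by (rule exp_decaying_bessel_gamma_factor[OF signs pq lam_less])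
    note lin = linear_growth_bessel_exponent[of n \<sigma>]
    have J: "bessel_J n \<sigma>s lam \<gamma> y = 1 / (2 * of_real pi) * power_integral ?g ?w y" if "y > 0" for y
      by (rule bessel_J_eq_power_integral[OF signs pq \<gamma> lam_less that])
    have deriv: "nth_deriv j (bessel_J n \<sigma>s lam \<gamma>) x = 1 / (2 * of_real pi) * power_integral ?q (\<lambda>t. ?w t - of_nat j) x"
      by (rule nth_deriv_power_integral(1)[OF dec lin J x0])
    define X where "X = x powr (- (real n * \<sigma>) - real j)"
    have "norm (power_integral ?q (\<lambda>t. ?w t - of_nat j) x) \<le> (H * c powr (P + real j) * X) * (2 / (1 / c))"
      unfolding power_integral_def
    proof (rule continuous_integrable_exp_bound(2))
      have "continuous_on UNIV ?w" "continuous_on UNIV ?g"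
        using lin dec unfolding linear_growth_on_line_def exp_decaying_def by auto
      then show "continuous_on UNIV (\<lambda>t. ?q t * of_real x powr (?w t - of_nat j))"
        using x0 by (intro continuous_on_mult continuous_on_prod continuous_on_diff continuous_on_of_real_powr continuous_on_const)
      show "1 / c > 0" using c by simp
      fix t
      have "norm (?g t) \<le> K ^ n * (1 + \<bar>t\<bar> + 2 * c) powr P * exp (- pi * max 0 (\<bar>t\<bar> - 2 * c))"
      proof -
        have "3/2 \<le> Re (Complex \<sigma> t - lam l) \<and> Re (Complex \<sigma> t - lam l) \<le> \<sigma> + \<bar>R\<bar> \<and> \<bar>Im (lam l)\<bar> \<le> 2 * c \<and> \<sigma>s l \<in> {1, -1}"
          if "l \<in> {1..n}" for l
        proof -
          have "3/2 \<le> \<sigma> - Re (lam l)" "\<sigma> - Re (lam l) \<le> \<sigma> + \<bar>R\<bar>"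
            using lam[OF that] unfolding \<sigma>_def by linarith+
          then show ?thesis using lam[OF that] by simp
        qed
        from G[OF this pq, unfolded lam0] show ?thesis by (simp add: P_def)
      qed
      moreover have "norm (\<Prod>i<j. ?w t - of_nat i) \<le> W * (1 + \<bar>t\<bar>) ^ j"
        unfolding W_def by (rule norm_falling_product_le)
      ultimately have "norm (?q t) \<le> (K ^ n * (1 + \<bar>t\<bar> + 2 * c) powr P * exp (- pi * max 0 (\<bar>t\<bar> - 2 * c))) * (W * (1 + \<bar>t\<bar>) ^ j)"
        unfolding norm_mult using K by (intro mult_mono) auto
      also have "\<dots> = K ^ n * W * ((1 + \<bar>t\<bar> + 2 * c) powr P * (1 + \<bar>t\<bar>) ^ j * exp (- pi * max 0 (\<bar>t\<bar> - 2 * c)))"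
        by (simp only: mult_ac)
      also have "\<dots> \<le> K ^ n * W * (5 powr (P + real j) * fact (nat \<lceil>P\<rceil> + j) * exp 3 * c powr (P + real j) * exp (- (1 / c) * \<bar>t\<bar>))"
        using K W by (intro mult_left_mono powr_mult_exp_excess_le c P0) auto
      also have "\<dots> = H * c powr (P + real j) * exp (- (1 / c) * \<bar>t\<bar>)" by (simp only: H_def mult_ac)
      finally have "norm (?q t) * X \<le> H * c powr (P + real j) * exp (- (1 / c) * \<bar>t\<bar>) * X"
        by (intro mult_right_mono) (auto simp: X_def)
      moreover have "norm (complex_of_real x powr (?w t - of_nat j)) = X"
        using x0 by (simp add: norm_of_real_powr X_def)
      ultimately show "norm (?q t * of_real x powr (?w t - of_nat j)) \<le> H * c powr (P + real j) * X * exp (- (1 / c) * \<bar>t\<bar>)"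
        unfolding norm_mult by (simp only: mult_ac)
    qed
    also have "\<dots> = 2 * H * (c powr (P + real j) * c) * X" by simp
    also have "c powr (P + real j) * c = c powr (P + real j + 1)" using c by (simp add: powr_add)
    also have "\<dots> \<le> c powr (real n * \<sigma> + real j)"
      using n c by (intro powr_mono) (auto simp: P_def)
    also have "2 * H * c powr (real n * \<sigma> + real j) * X = 2 * H * (c / x) powr (real n * \<sigma> + real j)"
    proof -
      have "X = x powr (- (real n * \<sigma> + real j))" unfolding X_def by (rule arg_cong[where f = "(powr) x"]) simp
      then have "c powr (real n * \<sigma> + real j) * X = (c / x) powr (real n * \<sigma> + real j)"
        by (simp only: powr_divide powr_minus_divide times_divide_eq_right mult_1_right)
      then show ?thesis by simp
    qed
    \<comment> \<open>Since c / x \<le> 1, the exponent may be lowered to M.\<close>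
    also have "(c / x) powr (real n * \<sigma> + real j) \<le> (c / x) powr real M"
    proof (rule powr_mono')
      have "real M \<le> 1 * \<sigma>" by (simp add: \<sigma>_def)
      also have "\<dots> \<le> real n * \<sigma>" using n by (intro mult_right_mono) (auto simp: \<sigma>_def)
      finally show "real M \<le> real n * \<sigma> + real j" by simp
    qed (use c x in auto)
    also have "(c / x) powr real M = (c / x) ^ M" using c x0 by (intro powr_realpow) simp
    finally have B: "norm (power_integral ?q (\<lambda>t. ?w t - of_nat j) x) \<le> 2 * H * (c / x) ^ M"
      using H X_def by (simp add: mult_left_mono mult_right_mono)
    have "norm (nth_deriv j (bessel_J n \<sigma>s lam \<gamma>) x) = norm (power_integral ?q (\<lambda>t. ?w t - of_nat j) x) / (2 * pi)"
      unfolding deriv by (simp add: norm_mult norm_divide)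
    also have "\<dots> \<le> norm (power_integral ?q (\<lambda>t. ?w t - of_nat j) x) / 2"
      using pi_gt3 by (intro divide_left_mono) auto
    also have "\<dots> \<le> H * (c / x) ^ M" using B by simp
    finally show ?thesis .
  qed
  then show ?thesis using that by blast
qed

section \<open>Passage from \<nu> to \<lambda>, and the theorem\<close>

lemma c_par_ge:
  assumes "l \<in> {1..d}"
  shows "cmod (\<nu> l) \<le> c_par d \<nu> - 1"
  using assms unfolding c_par_def by (auto intro!: Max_ge)

lemma r_par_ge:
  assumes "l \<in> {1..d}"
  shows "\<bar>Re (\<nu> l)\<bar> \<le> r_par d \<nu>"
  using assms unfolding r_par_def by (auto intro!: Max_ge)

lemma average_le:
  fixes f :: "nat \<Rightarrow> real"
  assumes "\<And>k. k \<in> {1..d} \<Longrightarrow> f k \<le> B" "B \<ge> 0"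
  shows "(\<Sum>k = 1..d. f k) / real (d + 1) \<le> B"
proof -
  have "(\<Sum>k = 1..d. f k) \<le> real d * B"
    using sum_bounded_above[of "{1..d}" f B] assms by simp
  also have "\<dots> \<le> real (d + 1) * B" using assms by (intro mult_right_mono) auto
  finally show ?thesis by (simp add: field_simps)
qed

text \<open>Each \<lambda> is an entry of \<nu>, or 0, minus the sum of all entries divided by d +
  1. Both parts obey the bound for a single entry, whence the factor 2.\<close>

lemma lambda_of_bounds:
  assumes d: "d \<ge> 1"
  shows "\<bar>Re (lambda_of d \<nu> l)\<bar> \<le> 2 * r_par d \<nu>" "\<bar>Im (lambda_of d \<nu> l)\<bar> \<le> 2 * c_par d \<nu>"
proof -
  define A where "A = (\<Sum>k = 1..d. \<nu> k) / of_nat (d + 1)"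
  define N where "N = (if l \<in> {1..d} then \<nu> l else 0)"
  have L: "lambda_of d \<nu> l = N - A" by (simp add: lambda_of_def A_def N_def)
  have r0: "r_par d \<nu> \<ge> 0" using r_par_ge[of 1 d \<nu>] d by (smt (verit) abs_ge_zero atLeastAtMost_iff order_refl)
  have c0: "c_par d \<nu> - 1 \<ge> 0" using c_par_ge[of 1 d \<nu>] d by (smt (verit) norm_ge_zero atLeastAtMost_iff order_refl)
  have "\<bar>Re A\<bar> \<le> (\<Sum>k = 1..d. \<bar>Re (\<nu> k)\<bar>) / real (d + 1)"
  proof -
    have "A = (\<Sum>k = 1..d. \<nu> k) / of_real (real (d + 1))" by (simp add: A_def)
    then have "Re A = (\<Sum>k = 1..d. Re (\<nu> k)) / real (d + 1)" by (simp only: Re_divide_of_real Re_sum)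
    then show ?thesis using sum_abs[of "\<lambda>k. Re (\<nu> k)" "{1..d}"] by (simp add: divide_right_mono)
  qed
  also have "\<dots> \<le> r_par d \<nu>" by (rule average_le[OF r_par_ge r0])
  finally have RA: "\<bar>Re A\<bar> \<le> r_par d \<nu>" .
  have "norm A \<le> (\<Sum>k = 1..d. cmod (\<nu> k)) / real (d + 1)"
    unfolding A_def norm_divide norm_of_nat by (intro divide_right_mono norm_sum) simp
  also have "\<dots> \<le> c_par d \<nu> - 1" by (rule average_le[OF c_par_ge c0])
  finally have cA: "norm A \<le> c_par d \<nu> - 1" .
  have RN: "\<bar>Re N\<bar> \<le> r_par d \<nu>" using r_par_ge[of l d \<nu>] r0 by (simp add: N_def)
  have cN: "norm N \<le> c_par d \<nu> - 1" using c_par_ge[of l d \<nu>] c0 by (simp add: N_def)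
  show "\<bar>Re (lambda_of d \<nu> l)\<bar> \<le> 2 * r_par d \<nu>" using RA RN by (simp add: L)
  show "\<bar>Im (lambda_of d \<nu> l)\<bar> \<le> 2 * c_par d \<nu>"
    using cA cN abs_Im_le_cmod[of A] abs_Im_le_cmod[of N] by (simp add: L)
qed

lemma sum_lambda_of: "(\<Sum>l = 1..d + 1. lambda_of d \<nu> l) = 0"
  using lambda_of_unique[where lam = "lambda_of d \<nu>" and d = d and \<nu> = \<nu>] by blast

lemma mixed_signs_obtain:
  fixes \<sigma>s :: "nat \<Rightarrow> int"
  assumes "\<forall>l\<in>{1..d + 1}. \<sigma>s l \<in> {1, -1}" "\<exists>l\<in>{1..d}. \<sigma>s l \<noteq> \<sigma>s (d + 1)"
  obtains p q where "p \<in> {1..d + 1}" "\<sigma>s p = 1" "q \<in> {1..d + 1}" "\<sigma>s q = -1"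
proof -
  obtain l where l: "l \<in> {1..d + 1}" "\<sigma>s l \<noteq> \<sigma>s (d + 1)" using assms(2) by force
  have e: "d + 1 \<in> {1..d + 1}" by simp
  show ?thesis
  proof (cases "\<sigma>s l = 1")
    case True
    then have "\<sigma>s (d + 1) = -1" using l(2) bspec[OF assms(1) e] by auto
    then show ?thesis using that[OF l(1) True e] by simp
  next
    case False
    then have "\<sigma>s l = -1" "\<sigma>s (d + 1) = 1" using l bspec[OF assms(1) e] bspec[OF assms(1) l(1)] by auto
    then show ?thesis using that[OF e _ l(1)] by simp
  qed
qed

lemma bessel_J_nu_eq: "bessel_J_nu d \<nu> \<sigma>s \<gamma> = bessel_J (d + 1) \<sigma>s (lambda_of d \<nu>) \<gamma>"
  by (simp add: fun_eq_iff bessel_J_nu_def)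

text \<open>\<open>nth_deriv\<close> is total, so the existence of the derivatives is a separate
  claim. It is purely qualitative, and the line \<sigma> may be taken from \<lambda> itself.\<close>

lemma nth_deriv_bessel_J_nu_differentiable:
  assumes signs: "\<forall>l\<in>{1..d + 1}. \<sigma>s l \<in> {1, -1}" "\<exists>l\<in>{1..d}. \<sigma>s l \<noteq> \<sigma>s (d + 1)"
    and \<gamma>: "bessel_contour (d + 1) (lambda_of d \<nu>) \<gamma>" and x: "x > 0"
  shows "nth_deriv i (bessel_J_nu d \<nu> \<sigma>s \<gamma>) differentiable (at x)"
proof -
  let ?lam = "lambda_of d \<nu>"
  obtain p q where pq: "p \<in> {1..d + 1}" "\<sigma>s p = 1" "q \<in> {1..d + 1}" "\<sigma>s q = -1"
    using mixed_signs_obtain[OF signs] by blast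
  define \<sigma> where "\<sigma> = (\<Sum>l = 1..d + 1. \<bar>Re (?lam l)\<bar>) + 1"
  have less: "Re (?lam l) < \<sigma>" if "l \<in> {1..d + 1}" for l
  proof -
    have "\<bar>Re (?lam l)\<bar> \<le> (\<Sum>l = 1..d + 1. \<bar>Re (?lam l)\<bar>)"
      by (rule member_le_sum) (use that in auto)
    then show ?thesis unfolding \<sigma>_def by linarith
  qed
  have s: "\<And>l. l \<in> {1..d + 1} \<Longrightarrow> \<sigma>s l \<in> {1, -1}" using signs(1) by blast
  show ?thesis unfolding bessel_J_nu_eq
    by (rule nth_deriv_power_integral(2)[OF exp_decaying_bessel_gamma_factor[OF s pq less]
          linear_growth_bessel_exponent bessel_J_eq_power_integral[OF s pq \<gamma> less] x])
qed

lemma nth_deriv_bessel_J_nu_bound: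
  assumes d: "d \<ge> 1"
  obtains K where "\<And>\<nu> \<sigma>s \<gamma> x. \<lbrakk>r_par d \<nu> = r; \<forall>l\<in>{1..d + 1}. \<sigma>s l \<in> {1, -1};
      \<exists>l\<in>{1..d}. \<sigma>s l \<noteq> \<sigma>s (d + 1); bessel_contour (d + 1) (lambda_of d \<nu>) \<gamma>; x \<ge> c_par d \<nu>\<rbrakk> \<Longrightarrow>
      cmod (nth_deriv j (bessel_J_nu d \<nu> \<sigma>s \<gamma>) x) \<le> K * (c_par d \<nu> / x) ^ M"
proof -
  have n: "d + 1 \<ge> 2" using d by simp
  obtain K where K: "\<And>lam \<sigma>s \<gamma> c p q x. \<lbrakk>c \<ge> 1; (\<Sum>l = 1..d + 1. lam l) = 0;
      \<And>l. l \<in> {1..d + 1} \<Longrightarrow> \<bar>Re (lam l)\<bar> \<le> 2 * r \<and> \<bar>Im (lam l)\<bar> \<le> 2 * c \<and> \<sigma>s l \<in> {1, -1};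
      p \<in> {1..d + 1}; \<sigma>s p = 1; q \<in> {1..d + 1}; \<sigma>s q = -1; bessel_contour (d + 1) lam \<gamma>; x \<ge> c\<rbrakk> \<Longrightarrow>
      norm (nth_deriv j (bessel_J (d + 1) \<sigma>s lam \<gamma>) x) \<le> K * (c / x) ^ M"
    using nth_deriv_bessel_J_bound[OF n, of "2 * r" j M] by blast
  have "cmod (nth_deriv j (bessel_J_nu d \<nu> \<sigma>s \<gamma>) x) \<le> K * (c_par d \<nu> / x) ^ M"
    if r: "r_par d \<nu> = r" and signs: "\<forall>l\<in>{1..d + 1}. \<sigma>s l \<in> {1, -1}" "\<exists>l\<in>{1..d}. \<sigma>s l \<noteq> \<sigma>s (d + 1)"
      and \<gamma>: "bessel_contour (d + 1) (lambda_of d \<nu>) \<gamma>" and x: "x \<ge> c_par d \<nu>"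
    for \<nu> \<sigma>s \<gamma> x
  proof -
    obtain p q where pq: "p \<in> {1..d + 1}" "\<sigma>s p = 1" "q \<in> {1..d + 1}" "\<sigma>s q = -1"
      using mixed_signs_obtain[OF signs] by blast
    have "0 \<le> cmod (\<nu> 1)" by simp
    also have "\<dots> \<le> c_par d \<nu> - 1" using d by (intro c_par_ge) simp
    finally have c: "1 \<le> c_par d \<nu>" by simp
    have "\<bar>Re (lambda_of d \<nu> l)\<bar> \<le> 2 * r \<and> \<bar>Im (lambda_of d \<nu> l)\<bar> \<le> 2 * c_par d \<nu> \<and> \<sigma>s l \<in> {1, -1}"
      if "l \<in> {1..d + 1}" for l
      using lambda_of_bounds[OF d, of \<nu> l] signs(1) that r by blast
    from K[OF c sum_lambda_of this pq \<gamma> x] show ?thesis unfolding bessel_J_nu_eq .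
  qed
  then show ?thesis using that by blast
qed

text \<open>The estimate with M = N + 1 leaves one factor 1/x after multiplication by x^N.\<close>

lemma bessel_J_nu_rapid_decay:
  assumes d: "d \<ge> 1" and signs: "\<forall>l\<in>{1..d + 1}. \<sigma>s l \<in> {1, -1}" "\<exists>l\<in>{1..d}. \<sigma>s l \<noteq> \<sigma>s (d + 1)"
    and \<gamma>: "bessel_contour (d + 1) (lambda_of d \<nu>) \<gamma>"
  shows "((\<lambda>x. x ^ N *\<^sub>R nth_deriv j (bessel_J_nu d \<nu> \<sigma>s \<gamma>) x) \<longlongrightarrow> 0) at_top"
proof -
  let ?c = "c_par d \<nu>"
  obtain K where K: "\<And>x. x \<ge> ?c \<Longrightarrow>
      cmod (nth_deriv j (bessel_J_nu d \<nu> \<sigma>s \<gamma>) x) \<le> K * (?c / x) ^ Suc N"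
    using nth_deriv_bessel_J_nu_bound[OF d, of "r_par d \<nu>" j "Suc N"] signs \<gamma> by metis
  show ?thesis
  proof (rule Lim_null_comparison)
    show "\<forall>\<^sub>F x in at_top. norm (x ^ N *\<^sub>R nth_deriv j (bessel_J_nu d \<nu> \<sigma>s \<gamma>) x) \<le> (K * ?c ^ Suc N) * inverse x"
      using eventually_ge_at_top[of ?c] eventually_gt_at_top[of 0]
    proof eventually_elim
      case (elim x)
      have "norm (x ^ N *\<^sub>R nth_deriv j (bessel_J_nu d \<nu> \<sigma>s \<gamma>) x) \<le> x ^ N * (K * (?c / x) ^ Suc N)"
        using mult_left_mono[OF K[OF elim(1)], of "x ^ N"] elim(2) by simp
      also have "\<dots> = (K * ?c ^ Suc N) * inverse x"
        using elim(2) by (simp add: field_simps)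
      finally show ?case .
    qed
    show "((\<lambda>x. (K * ?c ^ Suc N) * inverse x) \<longlongrightarrow> 0) at_top"
      by (intro tendsto_mult_right_zero tendsto_inverse_0_at_top filterlim_ident)
  qed
qed

text \<open>The place of the quantifier over \<open>K\<close>, after r, M, j and before \<nu>, the
  signs and the contour, encodes the permitted dependence of the implied constant. The
  differentiability clause for i < j makes the j-th derivative meaningful.\<close>

theorem theorem9p6:
  fixes d :: nat
  assumes "d \<ge> 1"
  shows "(\<forall>(r::real) (M::nat) (j::nat). \<exists>K::real.
            \<forall>(\<nu>::nat \<Rightarrow> complex) (\<sigma>s::nat \<Rightarrow> int) (\<gamma>::real \<Rightarrow> complex).
              r_par d \<nu> = r \<longrightarrow>
              (\<forall>l\<in>{1..d + 1}. \<sigma>s l \<in> {1, -1}) \<longrightarrow>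
              (\<exists>l\<in>{1..d}. \<sigma>s l \<noteq> \<sigma>s (d + 1)) \<longrightarrow>
              bessel_contour (d + 1) (lambda_of d \<nu>) \<gamma> \<longrightarrow>
              (\<forall>i<j. \<forall>x>0. nth_deriv i (bessel_J_nu d \<nu> \<sigma>s \<gamma>) differentiable (at x)) \<and>
              (\<forall>x\<ge>c_par d \<nu>.
                 cmod (nth_deriv j (bessel_J_nu d \<nu> \<sigma>s \<gamma>) x) \<le> K * (c_par d \<nu> / x) ^ M)) \<and>
         (\<forall>(\<nu>::nat \<Rightarrow> complex) (\<sigma>s::nat \<Rightarrow> int) (\<gamma>::real \<Rightarrow> complex).
            (\<forall>l\<in>{1..d + 1}. \<sigma>s l \<in> {1, -1}) \<longrightarrow>
            (\<exists>l\<in>{1..d}. \<sigma>s l \<noteq> \<sigma>s (d + 1)) \<longrightarrow>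
            bessel_contour (d + 1) (lambda_of d \<nu>) \<gamma> \<longrightarrow>
            (\<forall>(j::nat) (N::nat).
               ((\<lambda>x. x ^ N *\<^sub>R nth_deriv j (bessel_J_nu d \<nu> \<sigma>s \<gamma>) x) \<longlongrightarrow> 0) at_top))"
proof (intro conjI allI)
  fix r :: real and M j :: nat
  obtain K where K: "\<And>\<nu> \<sigma>s \<gamma> x. \<lbrakk>r_par d \<nu> = r; \<forall>l\<in>{1..d + 1}. \<sigma>s l \<in> {1, -1};
      \<exists>l\<in>{1..d}. \<sigma>s l \<noteq> \<sigma>s (d + 1); bessel_contour (d + 1) (lambda_of d \<nu>) \<gamma>; x \<ge> c_par d \<nu>\<rbrakk> \<Longrightarrow>
      cmod (nth_deriv j (bessel_J_nu d \<nu> \<sigma>s \<gamma>) x) \<le> K * (c_par d \<nu> / x) ^ M"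
    using nth_deriv_bessel_J_nu_bound[OF assms, of r j M] by blast
  show "\<exists>K::real. \<forall>(\<nu>::nat \<Rightarrow> complex) (\<sigma>s::nat \<Rightarrow> int) (\<gamma>::real \<Rightarrow> complex).
      r_par d \<nu> = r \<longrightarrow> (\<forall>l\<in>{1..d + 1}. \<sigma>s l \<in> {1, -1}) \<longrightarrow>
      (\<exists>l\<in>{1..d}. \<sigma>s l \<noteq> \<sigma>s (d + 1)) \<longrightarrow> bessel_contour (d + 1) (lambda_of d \<nu>) \<gamma> \<longrightarrow>
      (\<forall>i<j. \<forall>x>0. nth_deriv i (bessel_J_nu d \<nu> \<sigma>s \<gamma>) differentiable (at x)) \<and>
      (\<forall>x\<ge>c_par d \<nu>. cmod (nth_deriv j (bessel_J_nu d \<nu> \<sigma>s \<gamma>) x) \<le> K * (c_par d \<nu> / x) ^ M)"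
    using K nth_deriv_bessel_J_nu_differentiable by (intro exI[of _ K]) blast
next
  fix \<nu> :: "nat \<Rightarrow> complex" and \<sigma>s :: "nat \<Rightarrow> int" and \<gamma> :: "real \<Rightarrow> complex"
  show "(\<forall>l\<in>{1..d + 1}. \<sigma>s l \<in> {1, -1}) \<longrightarrow> (\<exists>l\<in>{1..d}. \<sigma>s l \<noteq> \<sigma>s (d + 1)) \<longrightarrow>
      bessel_contour (d + 1) (lambda_of d \<nu>) \<gamma> \<longrightarrow>
      (\<forall>(j::nat) (N::nat). ((\<lambda>x. x ^ N *\<^sub>R nth_deriv j (bessel_J_nu d \<nu> \<sigma>s \<gamma>) x) \<longlongrightarrow> 0) at_top)"
    using bessel_J_nu_rapid_decay[OF assms] by blast
qed

end
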